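(* For every sufficiently large $\sigma$ and every $s=\Omega(\sigma^{2})$, there exists a string $S$ of integers in $[0,\sigma)$ that can be described by an SLP $\mathcal{S}$ of size $s$, such that every top-tree compression $\mathcal{T}$ of the Cartesian tree $\mathcal{C}$ of $S$ has size $\Omega(s\cdot\sigma)$.
   Context: An SLP is a context-free grammar generating exactly one string, in which each rule's right-hand side is either two nonterminals or a single terminal; its size is its number of rules. The Cartesian tree of an empty string is empty; otherwise, with $i$ the index of the leftmost occurrence of the minimum of $S$, it is a root whose left subtree is the Cartesian tree of $S[1,i-1]$ and right subtree the Cartesian tree of $S[i+1,n]$ (an unlabeled rooted ordered binary tree). For a rooted ordered binary tree $T$, a cluster is a connected edge-subgraph with a top boundary node (its root) and at most one bottom boundary node (a leaf of the cluster), these being the only nodes of the cluster that may have neighbours outside it. A top-tree of $T$ is a rooted ordered binary tree whose leaves are the single-edge clusters of $T$ (labeled $e_\ell$ or $e_r$ according to whether the lower endpoint is a left or right child), whose root is the cluster of all of $T$, and each of whose internal nodes is the merge of the edge-disjoint clusters of its two children, horizontal (sharing top boundary node) or vertical (top boundary node of the left child cluster equals bottom boundary node of the right child cluster), the union being a cluster; internal nodes are labeled $h$ or $v$. A top-tree compression is the DAG of a top-tree with identical labeled subtrees represented once; its size is the number of DAG nodes (equivalently, the number of distinct clusters). *)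

theory Defs
  imports Complex_Main "HOL-Library.Tree" "HOL-Library.Sublist"
begin

section \<open>Straight-line programs\<close>

datatype ('n, 't) rhs = Pair 'n 'n | Term 't

type_synonym ('n, 't) rules = "('n \<times> ('n, 't) rhs) set"

inductive derives :: "('n, 't) rules \<Rightarrow> 'n \<Rightarrow> 't list \<Rightarrow> bool" for P where
  derives_Term: "(A, Term a) \<in> P \<Longrightarrow> derives P A [a]"
| derives_Pair: "(A, Pair B C) \<in> P \<Longrightarrow> derives P B u \<Longrightarrow> derives P C w \<Longrightarrow> derives P A (u @ w)"

definition language :: "('n, 't) rules \<Rightarrow> 'n \<Rightarrow> 't list set" where
  "language P A = {w. derives P A w}"

text \<open>The size of the program is \<open>card P\<close>.\<close>

definition slp_for :: "('n, 't) rules \<Rightarrow> 'n \<Rightarrow> 't list \<Rightarrow> bool" where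
  "slp_for P A S \<longleftrightarrow> finite P \<and> language P A = {S}"


section \<open>Cartesian trees\<close>

definition leftmost_min :: "'a::linorder list \<Rightarrow> nat" where
  "leftmost_min S = (LEAST i. i < length S \<and> S ! i = Min (set S))"

lemma leftmost_min_less: "S \<noteq> [] \<Longrightarrow> leftmost_min S < length S"
proof -
  assume "S \<noteq> []"
  then have "Min (set S) \<in> set S" by simp
  then have "\<exists>i. i < length S \<and> S ! i = Min (set S)" by (simp add: in_set_conv_nth)
  from LeastI_ex[OF this] show ?thesis unfolding leftmost_min_def by blast
qed

function cartesian_tree :: "'a::linorder list \<Rightarrow> unit tree" where
  "cartesian_tree S =
     (if S = [] then \<langle>\<rangle>
      else \<langle>cartesian_tree (take (leftmost_min S) S), (),
            cartesian_tree (drop (Suc (leftmost_min S)) S)\<rangle>)"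
  by auto
termination
proof (relation "measure length")
  fix S :: "'a list"
  assume "S \<noteq> []"
  from leftmost_min_less[OF this]
  show "(take (leftmost_min S) S, S) \<in> measure length"
    and "(drop (Suc (leftmost_min S)) S, S) \<in> measure length" by auto
qed simp

declare cartesian_tree.simps [simp del]


section \<open>Clusters and top-trees\<close>

text \<open>
  The nodes of a tree are the constructors \<^const>\<open>Node\<close> (a \<^const>\<open>Leaf\<close> is the empty tree),
  each given by the path that leads to it from the root.
\<close>

datatype dir = L | R

type_synonym node = "dir list"

primrec nodes :: "'a tree \<Rightarrow> node set" where
  "nodes \<langle>\<rangle> = {}"
| "nodes \<langle>l, a, r\<rangle> = {[]} \<union> (#) L ` nodes l \<union> (#) R ` nodes r"

definition edges :: "'a tree \<Rightarrow> (node \<times> node) set" where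
  "edges T = {(p, p @ [d]) | p d. p @ [d] \<in> nodes T}"

text \<open>
  \<open>cluster T C r B\<close>: the edge set \<open>C\<close> is a cluster of \<open>T\<close> with top boundary node \<open>r\<close> and bottom
  boundary node \<open>b\<close> if \<open>B = Some b\<close>, and none if \<open>B = None\<close>. The vertices of \<open>C\<close> are \<open>Field C\<close>;
  edges point downwards, so the fifth conjunct says that \<open>C\<close> is connected with root \<open>r\<close>, and
  a leaf of \<open>C\<close> is a vertex outside \<open>Domain C\<close>.
\<close>

definition cluster :: "'a tree \<Rightarrow> (node \<times> node) set \<Rightarrow> node \<Rightarrow> node option \<Rightarrow> bool" where
  "cluster T C r B \<longleftrightarrow>
     C \<noteq> {} \<and> C \<subseteq> edges T \<and>
     set_option B \<subseteq> Field C - Domain C \<and>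
     r \<in> Field C \<and> (\<forall>v\<in>Field C. (r, v) \<in> C\<^sup>*) \<and>
     (\<forall>v\<in>Field C. \<forall>w. (v, w) \<in> edges T \<union> (edges T)\<inverse> \<and> w \<notin> Field C
        \<longrightarrow> v = r \<or> v \<in> set_option B)"

datatype label = Edge dir | Horizontal | Vertical

text \<open>
  \<open>top_tree_of T C t\<close>: the labelled tree \<open>t\<close> is built from single-edge clusters of \<open>T\<close> by merges
  and its root is the cluster \<open>C\<close>. In a vertical merge the left child is the lower cluster.
\<close>

inductive top_tree_of :: "'a tree \<Rightarrow> (node \<times> node) set \<Rightarrow> label tree \<Rightarrow> bool" for T where
  single_edge:
    "(p, p @ [d]) \<in> edges T \<Longrightarrow> top_tree_of T {(p, p @ [d])} \<langle>\<langle>\<rangle>, Edge d, \<langle>\<rangle>\<rangle>"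
| horizontal_merge:
    "\<lbrakk>top_tree_of T C1 t1; top_tree_of T C2 t2; C1 \<inter> C2 = {};
      cluster T C1 r B1; cluster T C2 r B2; cluster T (C1 \<union> C2) r' B\<rbrakk>
     \<Longrightarrow> top_tree_of T (C1 \<union> C2) \<langle>t1, Horizontal, t2\<rangle>"
| vertical_merge:
    "\<lbrakk>top_tree_of T C1 t1; top_tree_of T C2 t2; C1 \<inter> C2 = {};
      cluster T C1 v B1; cluster T C2 r (Some v); cluster T (C1 \<union> C2) r' B\<rbrakk>
     \<Longrightarrow> top_tree_of T (C1 \<union> C2) \<langle>t1, Vertical, t2\<rangle>"

text \<open>
  A tree without edges has no clusters; its only top-tree is the empty one. With this convention
  every tree has a top-tree (\<open>top_tree_exists\<close> below).
\<close>

definition top_tree :: "'a tree \<Rightarrow> label tree \<Rightarrow> bool" where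
  "top_tree T t \<longleftrightarrow> (if edges T = {} then t = \<langle>\<rangle> else top_tree_of T (edges T) t)"

text \<open>
  The DAG that represents identical labelled subtrees of a top-tree once has one node for each
  distinct non-empty subtree.
\<close>

definition dag_size :: "'a tree \<Rightarrow> nat" where
  "dag_size t = card (subtrees t - {\<langle>\<rangle>})"


subsection \<open>Every tree has a top-tree\<close>

lemma finite_nodes: "finite (nodes T)"
  by (induction T) auto

lemma nodes_butlast: "p @ [d] \<in> nodes T \<Longrightarrow> p \<in> nodes T"
proof (induction T arbitrary: p)
  case (Node l a r)
  then show ?case by (cases p) auto
qed simp

lemma nodes_append: "p @ q \<in> nodes T \<Longrightarrow> p \<in> nodes T"
proof (induction q rule: rev_induct)
  case (snoc x xs)
  then show ?case using nodes_butlast[of "p @ xs" x T] by simp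
qed simp

definition below :: "'a tree \<Rightarrow> node \<Rightarrow> (node \<times> node) set" where
  "below T p = {(u, v) \<in> edges T. prefix p u}"

definition branch :: "'a tree \<Rightarrow> node \<Rightarrow> dir \<Rightarrow> (node \<times> node) set" where
  "branch T p d = {(u, v) \<in> edges T. prefix (p @ [d]) v}"

lemma edgesD: "(u, v) \<in> edges T \<Longrightarrow> (\<exists>d. v = u @ [d]) \<and> u \<in> nodes T \<and> v \<in> nodes T"
  unfolding edges_def using nodes_butlast by blast

lemma edgesI: "p @ [d] \<in> nodes T \<Longrightarrow> (p, p @ [d]) \<in> edges T"
  unfolding edges_def by blast

lemma below_reach: "p @ q \<in> nodes T \<Longrightarrow> (p, p @ q) \<in> (below T p)\<^sup>*"
proof (induction q rule: rev_induct)
  case (snoc d q)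
  then have *: "(p @ q) @ [d] \<in> nodes T" by simp
  have "(p @ q, p @ q @ [d]) \<in> below T p"
    using edgesI[OF *] by (simp add: below_def)
  then show ?case using snoc nodes_butlast[OF *] by (meson rtrancl.rtrancl_into_rtrancl)
qed simp

lemma below_split: "below T p = branch T p L \<union> branch T p R"
proof -
  have "prefix p u \<longleftrightarrow> prefix (p @ [L]) v \<or> prefix (p @ [R]) v" if e: "(u, v) \<in> edges T" for u v
  proof -
    obtain d where v: "v = u @ [d]" using edgesD[OF e] by blast
    have "\<exists>d'. prefix (p @ [d']) v" if pu: "prefix p u"
    proof -
      from pu obtain q where u: "u = p @ q" by (auto simp: prefix_def)
      then have "prefix (p @ [hd (q @ [d])]) v" unfolding v by (cases q) auto
      then show ?thesis by blast
    qed
    moreover have "prefix p u" if "prefix (p @ [d']) v" for d'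
      using that unfolding v by (metis append_prefixD prefix_snoc append1_eq_conv prefix_order.refl)
    moreover have "d' = L \<or> d' = R" for d' by (cases d') auto
    ultimately show ?thesis by metis
  qed
  then show ?thesis unfolding below_def branch_def by auto
qed

lemma branch_split:
  assumes "p @ [d] \<in> nodes T"
  shows "branch T p d = below T (p @ [d]) \<union> {(p, p @ [d])}"
proof -
  have "prefix (p @ [d]) v \<longleftrightarrow> prefix (p @ [d]) u \<or> (u = p \<and> v = p @ [d])"
    if "(u, v) \<in> edges T" for u v
    using edgesD[OF that] by (auto simp: prefix_snoc)
  then show ?thesis using edgesI[OF assms] unfolding below_def branch_def by auto
qed

lemma branch_empty: "p @ [d] \<notin> nodes T \<Longrightarrow> branch T p d = {}"
  using nodes_append[of "p @ [d]"] edgesD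
  by (fastforce simp: branch_def prefix_def simp del: append_assoc)

lemma branch_disjoint: "branch T p L \<inter> branch T p R = {}"
  by (auto simp: branch_def prefix_def)

lemma Field_below: "v \<in> Field (below T p) \<Longrightarrow> \<exists>q. v = p @ q \<and> p @ q \<in> nodes T"
  unfolding below_def Field_def using edgesD by (fastforce simp: prefix_def)

lemma cluster_single: "p @ [d] \<in> nodes T \<Longrightarrow> cluster T {(p, p @ [d])} p (Some (p @ [d]))"
  by (auto simp: cluster_def Field_def edgesI)

lemma below_adj:
  assumes "(v, w) \<in> edges T \<union> (edges T)\<inverse>" "v = p @ q" "q \<noteq> []"
  shows "w \<in> Field (below T p)"
proof -
  have "prefix p v \<and> (v, w) \<in> edges T \<or> prefix p w \<and> (w, v) \<in> edges T"
  proof (cases "(v, w) \<in> edges T")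
    case False
    then have e: "(w, v) \<in> edges T" using assms by auto
    then obtain d where "v = w @ [d]" using edgesD by blast
    then have "prefix p w" using assms(2,3) by (cases q rule: rev_cases) auto
    then show ?thesis using e by simp
  qed (use assms in auto)
  then show ?thesis by (auto simp: below_def Field_def)
qed

lemma cluster_below:
  assumes "below T p \<noteq> {}"
  shows "cluster T (below T p) p None"
proof -
  obtain u v where "(u, v) \<in> below T p" using assms by auto
  then have "v \<in> Field (below T p)" by (auto simp: Field_def)
  moreover have reach: "(p, v) \<in> (below T p)\<^sup>*" if "v \<in> Field (below T p)" for v
    using Field_below[OF that] below_reach by blast
  ultimately have "p \<in> Field (below T p)"
    by (metis FieldI1 converse_rtranclE)
  moreover have "v = p"
    if "v \<in> Field (below T p)" "(v, w) \<in> edges T \<union> (edges T)\<inverse>" "w \<notin> Field (below T p)" for v w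
    using Field_below[OF that(1)] below_adj[OF that(2)] that(3) by fastforce
  moreover have "below T p \<subseteq> edges T" by (auto simp: below_def)
  ultimately show ?thesis using assms reach unfolding cluster_def by auto
qed

lemma cluster_branch:
  assumes "p @ [d] \<in> nodes T"
  shows "cluster T (branch T p d) p None"
proof -
  let ?B = "below T (p @ [d])" and ?C = "branch T p d"
  have C: "?C = ?B \<union> {(p, p @ [d])}" by (rule branch_split[OF assms])
  have F: "Field ?C = Field ?B \<union> {p, p @ [d]}" unfolding C by (auto simp: Field_def)
  have sub: "?B\<^sup>* \<subseteq> ?C\<^sup>*" unfolding C by (rule rtrancl_mono) auto
  have e: "(p, p @ [d]) \<in> ?C" unfolding C by simp
  have "(p, v) \<in> ?C\<^sup>*" if v: "v \<in> Field ?C" for v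
  proof (cases "v = p")
    case False
    then obtain q where "v = (p @ [d]) @ q" "(p @ [d]) @ q \<in> nodes T"
      using v assms Field_below unfolding F by fastforce
    with below_reach have "(p @ [d], v) \<in> ?B\<^sup>*" by metis
    then show ?thesis using sub e by (meson converse_rtrancl_into_rtrancl subsetD)
  qed simp
  moreover have "v = p"
    if v: "v \<in> Field ?C" "(v, w) \<in> edges T \<union> (edges T)\<inverse>" "w \<notin> Field ?C" for v w
  proof (rule ccontr)
    assume "v \<noteq> p"
    then obtain q where q: "v = (p @ [d]) @ q"
      using v(1) Field_below unfolding F by fastforce
    show False
    proof (cases "q = []")
      case False
      then show False using below_adj[OF v(2) q] v(3) F by blast
    next
      case True
      from v(2) show False
      proof
        assume "(v, w) \<in> edges T"
        then have "(v, w) \<in> ?B" using True q by (auto simp: below_def)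
        then show False using v(3) F by (auto simp: Field_def)
      next
        assume "(v, w) \<in> (edges T)\<inverse>"
        then have "w = p" using edgesD True q by fastforce
        then show False using v(3) F by auto
      qed
    qed
  qed
  moreover have "?C \<subseteq> edges T" by (auto simp: branch_def)
  ultimately show ?thesis using e F unfolding cluster_def by auto
qed

lemma top_tree_of_below: "below T p \<noteq> {} \<Longrightarrow> \<exists>t. top_tree_of T (below T p) t"
proof (induction "card (below T p)" arbitrary: p rule: less_induct)
  case less
  have br: "\<exists>t. top_tree_of T (branch T p d) t" if n: "p @ [d] \<in> nodes T" for d
  proof (cases "below T (p @ [d]) = {}")
    case True
    then show ?thesis
      using single_edge[OF edgesI[OF n]] branch_split[OF n] by auto
  next
    case False
    let ?e = "(p, p @ [d])"
    have notin: "?e \<notin> below T (p @ [d])" by (auto simp: below_def prefix_def)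
    have "below T (p @ [d]) \<subset> below T p"
    proof (rule psubsetI)
      show "below T (p @ [d]) \<subseteq> below T p" by (auto simp: below_def prefix_def)
      have "?e \<in> below T p" using edgesI[OF n] by (simp add: below_def)
      then show "below T (p @ [d]) \<noteq> below T p" using notin by blast
    qed
    moreover have "finite (below T p)"
    proof (rule finite_subset)
      show "below T p \<subseteq> nodes T \<times> nodes T" using edgesD by (fastforce simp: below_def)
    qed (simp add: finite_nodes)
    ultimately obtain t where t: "top_tree_of T (below T (p @ [d])) t"
      using less.hyps[of "p @ [d]"] False psubset_card_mono by blast
    have "cluster T (below T (p @ [d]) \<union> {?e}) p None"
      using cluster_branch[OF n] branch_split[OF n] by metis
    from vertical_merge[OF t single_edge[OF edgesI[OF n]] _ cluster_below[OF False]
        cluster_single[OF n] this] notin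
    show ?thesis using branch_split[OF n] by auto
  qed
  show ?case
  proof (cases "p @ [L] \<in> nodes T \<and> p @ [R] \<in> nodes T")
    case True
    then obtain t1 t2 where "top_tree_of T (branch T p L) t1" "top_tree_of T (branch T p R) t2"
      using br by blast
    from horizontal_merge[OF this branch_disjoint, of p None None p None]
    show ?thesis using True cluster_branch cluster_below[OF less.prems] below_split by metis
  next
    case False
    then show ?thesis using br branch_empty below_split less.prems by (metis Un_empty_left Un_empty_right)
  qed
qed

lemma top_tree_exists: "\<exists>t. top_tree T t"
proof (cases "edges T = {}")
  case False
  moreover have "below T [] = edges T" by (auto simp: below_def)
  ultimately show ?thesis using top_tree_of_below[of T "[]"] by (simp add: top_tree_def)
qed (simp add: top_tree_def)

end

theory Submission
  imports Defs
begin

text \<open>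
  A label tree need not determine the shape of its cluster, because the labels do not say which leaf
  is the bottom boundary. It does determine how many left and how many right edges the cluster
  has, so it suffices to find \<open>\<Omega>(s \<sigma>)\<close> nodes of the top-tree with distinct pairs of edge counts.

  The Cartesian tree is a right spine on which \<open>p\<^sup>2\<close> blocks hang, \<open>p = \<Theta>(\<surd>s)\<close>. Block \<open>(i, j)\<close> comes from
  concatenating a word \<open>A i\<close>, which contributes the even vertices of a zigzag of \<open>m = \<Theta>(\<sigma>)\<close> levels,
  and a word \<open>B j\<close>, which contributes the odd ones. At level \<open>k\<close> hang a comb of size \<open>8 ^ (C + p k + i)\<close>
  and a right path of size \<open>8 ^ (C' + p k + j)\<close>. Only the combs have many left edges, and the paths
  outweigh all combs. For each block and level take the smallest cluster of the top-tree that contains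
  the edges into the level and into the next one. If it stays inside the block, its two edge
  counts reveal \<open>i\<close>, \<open>j\<close> and the deepest level it reaches; hence two such clusters with equal counts
  intersect, are nested by laminarity, and coincide. If it leaves the block, it contains the last
  vertex of the right spine, so any two such clusters are nested and their sizes differ. One of
  the two kinds makes up half of the \<open>p\<^sup>2 m\<close> clusters. The words \<open>A i\<close> and \<open>B j\<close> need \<open>O(p m)\<close> rules in
  total and each block needs \<open>O(1)\<close> more, and \<open>p m \<le> p\<^sup>2\<close> because \<open>s = \<Omega>(\<sigma>\<^sup>2)\<close>.
\<close>

section \<open>Straight-line programs from sets of factors\<close>

text \<open>Each word of \<open>W\<close> becomes a nonterminal whose rule splits it into two
  members of \<open>W\<close>. Nonempty parts make both parts shorter, so induction on the length
  yields the derivations.\<close>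

lemma slp_of_closed_words:
  fixes W :: "'t list set"
  assumes "finite W" "card W \<le> s" "S \<in> W"
    and closed: "\<And>w. w \<in> W \<Longrightarrow>
      (\<exists>a. w = [a]) \<or> (\<exists>u\<in>W. \<exists>v\<in>W. u \<noteq> [] \<and> v \<noteq> [] \<and> w = u @ v)"
  shows "\<exists>(P :: (nat, 't) rules) A. slp_for P A S \<and> card P = s"
proof -
  obtain f where f: "f ` W \<subseteq> {..<s}" "inj_on f W"
    using card_le_inj[of W "{..<s}"] assms by auto
  \<comment> \<open>Numbers below \<open>s\<close> that name no word of \<open>W\<close> become
    further copies of \<open>S\<close>. This pads the program to exactly \<open>s\<close>
    rules.\<close>
  define val where "val n = (if n \<in> f ` W then inv_into W f n else S)" for n
  have val_in: "val n \<in> W" for n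
    using assms(3) by (auto simp: val_def inv_into_into)
  have val_ex: "\<exists>n<s. val n = w" if "w \<in> W" for w
    using that f by (intro exI[of _ "f w"]) (auto simp: val_def)
  define produces where "produces r w \<longleftrightarrow> (case r of Term a \<Rightarrow> w = [a]
      | Pair B C \<Rightarrow> B < s \<and> C < s \<and> val B \<noteq> [] \<and> val C \<noteq> [] \<and> w = val B @ val C)" for r w
  have "\<exists>r. produces r (val n)" for n
    using closed[OF val_in[of n]]
  proof
    assume "\<exists>a. val n = [a]"
    then obtain a where "val n = [a]" ..
    then have "produces (Term a) (val n)" by (simp add: produces_def)
    then show ?thesis ..
  next
    assume "\<exists>u\<in>W. \<exists>v\<in>W. u \<noteq> [] \<and> v \<noteq> [] \<and> val n = u @ v"
    then obtain B C where "B < s" "C < s" "val B \<noteq> []" "val C \<noteq> []" "val n = val B @ val C"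
      using val_ex by metis
    then have "produces (Pair B C) (val n)" by (simp add: produces_def)
    then show ?thesis ..
  qed
  then obtain rule where rule: "\<And>n. produces (rule n) (val n)" by metis
  define P where "P = (\<lambda>n. (n, rule n)) ` {..<s}"
  have P_iff: "(n, r) \<in> P \<longleftrightarrow> n < s \<and> r = rule n" for n r
    by (auto simp: P_def)
  have "derives P n w \<Longrightarrow> w = val n" for n w
  proof (induction rule: derives.induct)
    case (derives_Term n a)
    then have "rule n = Term a" by (simp add: P_iff)
    then show ?case using rule[of n] by (simp add: produces_def)
  next
    case (derives_Pair n B C u w)
    then have "rule n = Pair B C" by (simp add: P_iff)
    then show ?case using rule[of n] derives_Pair.IH by (simp add: produces_def)
  qed
  moreover have "n < s \<Longrightarrow> derives P n (val n)" for n
  proof (induction "length (val n)" arbitrary: n rule: less_induct)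
    case less
    show ?case
    proof (cases "rule n")
      case (Term a)
      then have "val n = [a]" "(n, Term a) \<in> P"
        using rule[of n] less.prems by (simp_all add: P_iff produces_def)
      then show ?thesis by (simp add: derives_Term)
    next
      case (Pair B C)
      then have "B < s" "C < s" "length (val B) < length (val n)" "length (val C) < length (val n)"
        and n: "val n = val B @ val C"
        using rule[of n] by (simp_all add: produces_def)
      then have "derives P B (val B)" "derives P C (val C)" using less.hyps by auto
      moreover have "(n, Pair B C) \<in> P" using Pair less.prems by (simp add: P_iff)
      ultimately show ?thesis unfolding n by (blast intro: derives_Pair)
    qed
  qed
  moreover obtain A where "A < s" "val A = S" using val_ex assms(3) by blast
  ultimately have "language P A = {S}" by (auto simp: language_def)
  then have "slp_for P A S" by (simp add: slp_for_def P_def)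
  moreover have "card P = s" unfolding P_def by (subst card_image) (auto simp: inj_on_def)
  ultimately show ?thesis by blast
qed

section \<open>Cartesian trees of the building blocks\<close>

text \<open>The hypothesis is strict on the left only, because ties for the minimum are broken
  towards the leftmost occurrence.\<close>

lemma cartesian_tree_split:
  fixes m :: "'a::linorder"
  assumes "\<forall>x\<in>set xs. m < x" "\<forall>y\<in>set ys. m \<le> y"
  shows "cartesian_tree (xs @ m # ys) = \<langle>cartesian_tree xs, (), cartesian_tree ys\<rangle>"
proof -
  have Min: "Min (set (xs @ m # ys)) = m"
    by (rule Min_eqI) (use assms in \<open>auto intro: less_imp_le\<close>)
  have "leftmost_min (xs @ m # ys) = length xs"
    unfolding leftmost_min_def Min
  proof (rule Least_equality)
    fix i assume i: "i < length (xs @ m # ys) \<and> (xs @ m # ys) ! i = m"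
    show "length xs \<le> i"
    proof (rule ccontr)
      assume "\<not> length xs \<le> i"
      then have "xs ! i \<in> set xs" "xs ! i = m" using i by (auto simp: nth_append)
      then show False using assms(1) by auto
    qed
  qed simp
  then show ?thesis by (subst cartesian_tree.simps) simp
qed

lemma cartesian_tree_Nil: "cartesian_tree [] = \<langle>\<rangle>"
  by (simp add: cartesian_tree.simps)

primrec right_path :: "nat \<Rightarrow> unit tree" where
  "right_path 0 = \<langle>\<rangle>"
| "right_path (Suc w) = \<langle>\<langle>\<rangle>, (), right_path w\<rangle>"

text \<open>Each of the \<open>w\<close> vertices of a right path carries one left leaf. So a comb
  supplies \<open>w\<close> left edges, while all edges of \<open>right_path\<close> are right
  edges.\<close>

primrec comb :: "nat \<Rightarrow> unit tree" where
  "comb 0 = \<langle>\<rangle>"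
| "comb (Suc w) = \<langle>\<langle>\<langle>\<rangle>, (), \<langle>\<rangle>\<rangle>, (), comb w\<rangle>"

primrec zigzag :: "(nat \<Rightarrow> nat) \<Rightarrow> (nat \<Rightarrow> nat) \<Rightarrow> nat \<Rightarrow> nat \<Rightarrow> unit tree" where
  "zigzag f g k 0 = \<langle>\<rangle>"
| "zigzag f g k (Suc n) =
     \<langle>comb (f k), (), \<langle>zigzag f g (Suc k) n, (), right_path (g k)\<rangle>\<rangle>"

primrec right_spine :: "unit tree list \<Rightarrow> unit tree" where
  "right_spine [] = \<langle>\<langle>\<rangle>, (), \<langle>\<rangle>\<rangle>"
| "right_spine (t # ts) = \<langle>t, (), right_spine ts\<rangle>"

definition comb_word :: "nat \<Rightarrow> nat \<Rightarrow> nat list" where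
  "comb_word x w = concat (replicate w [Suc x, x])"

primrec zigzag_word :: "nat \<Rightarrow> (nat \<Rightarrow> nat) \<Rightarrow> (nat \<Rightarrow> nat) \<Rightarrow> nat \<Rightarrow> nat \<Rightarrow> nat list" where
  "zigzag_word x f g k 0 = []"
| "zigzag_word x f g k (Suc n) =
     comb_word x (f k) @ (2 * k + 1) # zigzag_word x f g (Suc k) n
       @ (2 * k + 2) # replicate (g k) x"

primrec spine_word :: "nat list list \<Rightarrow> nat list" where
  "spine_word [] = [0]"
| "spine_word (w # ws) = w @ 0 # spine_word ws"

lemma set_comb_word: "set (comb_word x w) \<subseteq> {x, Suc x}"
  by (induction w) (auto simp: comb_word_def)

lemma cartesian_tree_replicate: "cartesian_tree (replicate w x) = right_path w"
proof (induction w)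
  case (Suc w)
  then show ?case using cartesian_tree_split[of "[]" x "replicate w x"]
    by (simp add: cartesian_tree_Nil)
qed (simp add: cartesian_tree_Nil)

lemma cartesian_tree_comb_word: "cartesian_tree (comb_word x w) = comb w"
proof (induction w)
  case 0
  then show ?case by (simp add: comb_word_def cartesian_tree_Nil)
next
  case (Suc w)
  have "cartesian_tree ([Suc x] @ x # comb_word x w)
    = \<langle>cartesian_tree [Suc x], (), cartesian_tree (comb_word x w)\<rangle>"
    by (rule cartesian_tree_split) (use set_comb_word[of x w] in auto)
  then show ?case using Suc cartesian_tree_replicate[of 1 "Suc x"]
    by (simp add: comb_word_def)
qed

lemma set_zigzag_word:
  "2 * (k + n) < x \<Longrightarrow> set (zigzag_word x f g k n) \<subseteq> {2 * k + 1..Suc x}"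
proof (induction n arbitrary: k)
  case (Suc n)
  have "set (zigzag_word x f g (Suc k) n) \<subseteq> {2 * Suc k + 1..Suc x}"
    using Suc.prems by (intro Suc.IH) simp
  also have "\<dots> \<subseteq> {2 * k + 1..Suc x}" by simp
  finally show ?case using Suc.prems set_comb_word[of x "f k"] by (auto simp: set_replicate_conv_if)
qed simp

text \<open>The separators \<open>2 * k + 1\<close> and \<open>2 * k + 2\<close> increase with the
  level, and \<open>x\<close> exceeds all of them. Hence the two separators of the outermost level
  are, in this order, the successive leftmost minima.\<close>

lemma cartesian_tree_zigzag_word:
  "2 * (k + n) < x \<Longrightarrow> cartesian_tree (zigzag_word x f g k n) = zigzag f g k n"
proof (induction n arbitrary: k)
  case (Suc n)
  let ?rest = "zigzag_word x f g (Suc k) n"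
  have rest: "set ?rest \<subseteq> {2 * Suc k + 1..Suc x}"
    using set_zigzag_word[of "Suc k" n x f g] Suc.prems by simp
  have "cartesian_tree (zigzag_word x f g k (Suc n)) = \<langle>cartesian_tree (comb_word x (f k)), (),
      cartesian_tree (?rest @ (2 * k + 2) # replicate (g k) x)\<rangle>"
    unfolding zigzag_word.simps
    by (rule cartesian_tree_split) (use Suc.prems rest set_comb_word[of x "f k"] in fastforce)+
  also have "cartesian_tree (?rest @ (2 * k + 2) # replicate (g k) x) =
      \<langle>cartesian_tree ?rest, (), cartesian_tree (replicate (g k) x)\<rangle>"
    by (rule cartesian_tree_split) (use Suc.prems rest in fastforce)+
  finally show ?case
    using Suc by (simp add: cartesian_tree_replicate cartesian_tree_comb_word)
qed (simp add: cartesian_tree_Nil)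

lemma cartesian_tree_spine_word:
  "\<forall>w\<in>set ws. 0 \<notin> set w \<Longrightarrow>
    cartesian_tree (spine_word ws) = right_spine (map cartesian_tree ws)"
proof (induction ws)
  case Nil
  then show ?case using cartesian_tree_split[of "[]" "0::nat" "[]"]
    by (simp add: cartesian_tree_Nil)
next
  case (Cons w ws)
  have "cartesian_tree (w @ 0 # spine_word ws)
      = \<langle>cartesian_tree w, (), cartesian_tree (spine_word ws)\<rangle>"
    by (rule cartesian_tree_split) (use Cons.prems in \<open>auto intro: gr0I\<close>)
  then show ?case using Cons by simp
qed

lemma comb_word_add: "comb_word x (a + b) = comb_word x a @ comb_word x b"
  by (simp add: comb_word_def replicate_add)

lemma comb_word_eq_Nil: "comb_word x w = [] \<longleftrightarrow> w = 0"
  by (cases w) (auto simp: comb_word_def)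

text \<open>At each level the part for \<open>f\<close> stands before the deeper levels and the part
  for \<open>g\<close> after them. So the word is a prefix depending on \<open>f\<close> alone and a
  suffix depending on \<open>g\<close> alone, which a program can share between blocks.\<close>

lemma zigzag_word_split:
  "zigzag_word x f g k n = concat (map (\<lambda>l. comb_word x (f l) @ [2 * l + 1]) [k..<k + n])
     @ concat (map (\<lambda>l. (2 * l + 2) # replicate (g l) x) (rev [k..<k + n]))"
proof (induction n arbitrary: k)
  case (Suc n)
  have "[k..<k + Suc n] = k # [Suc k..<Suc k + n]" by (simp add: upt_rec)
  then show ?case using Suc[of "Suc k"] by simp
qed simp

section \<open>Addresses of the vertices of blocks and spine\<close>

definition zig :: "nat \<Rightarrow> node" where
  "zig k = concat (replicate k [R, L])"

lemma zig_0 [simp]: "zig 0 = []" by (simp add: zig_def)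

lemma zig_Suc: "zig (Suc k) = R # L # zig k" by (simp add: zig_def)

lemma zig_Suc_snoc: "zig (Suc k) = zig k @ [R, L]"
  by (induction k) (simp_all add: zig_Suc)

lemma prefix_zig: "k \<le> l \<Longrightarrow> prefix (zig k) (zig l)"
  by (induction rule: dec_induct) (auto simp: zig_Suc_snoc intro: prefix_order.trans)

lemma nodes_right_path: "nodes (right_path w) = (\<lambda>i. replicate i R) ` {..<w}"
  by (induction w) (auto simp: lessThan_Suc_eq_insert_0 image_image)

lemma nodes_comb:
  "nodes (comb w) = (\<lambda>i. replicate i R) ` {..<w} \<union> (\<lambda>i. replicate i R @ [L]) ` {..<w}"
  by (induction w) (auto simp: lessThan_Suc_eq_insert_0 image_image)

lemma nodes_zigzag:
  "z \<in> nodes (zigzag f g k n) \<longleftrightarrow>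
    (\<exists>l<n. z = zig l \<or> z = zig l @ [R] \<or>
      (\<exists>y\<in>nodes (comb (f (k + l))). z = zig l @ L # y) \<or>
      (\<exists>y\<in>nodes (right_path (g (k + l))). z = zig l @ R # R # y))"
proof (induction n arbitrary: k z)
  case (Suc n)
  have "z \<in> nodes (zigzag f g k (Suc n)) \<longleftrightarrow> z = [] \<or> z = [R] \<or>
      (\<exists>y\<in>nodes (comb (f k)). z = L # y) \<or>
      (\<exists>y\<in>nodes (right_path (g k)). z = R # R # y) \<or>
      (\<exists>y\<in>nodes (zigzag f g (Suc k) n). z = R # L # y)"
    by auto
  moreover have "(\<exists>y\<in>nodes (zigzag f g (Suc k) n). z = R # L # y) \<longleftrightarrow>
      (\<exists>l<n. z = zig (Suc l) \<or> z = zig (Suc l) @ [R] \<or>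
        (\<exists>y\<in>nodes (comb (f (k + Suc l))). z = zig (Suc l) @ L # y) \<or>
        (\<exists>y\<in>nodes (right_path (g (k + Suc l))). z = zig (Suc l) @ R # R # y))"
    unfolding Bex_def Suc.IH zig_Suc append_Cons add_Suc_right add_Suc by blast
  ultimately show ?case
    unfolding Ex_less_Suc2 by (simp only: zig_0 append_Nil add_0_right simp_thms disj_assoc)
qed simp

lemma nodes_right_spine:
  "z \<in> nodes (right_spine ts) \<longleftrightarrow>
    (\<exists>n\<le>length ts. z = replicate n R) \<or>
    (\<exists>n<length ts. \<exists>y\<in>nodes (ts ! n). z = replicate n R @ L # y)"
proof (induction ts arbitrary: z)
  case (Cons t ts)
  have *: "(\<exists>n\<le>Suc N. P n) \<longleftrightarrow> P 0 \<or> (\<exists>n\<le>N. P (Suc n))" for P N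
    by (metis Suc_le_mono le0 not0_implies_Suc)
  have "z \<in> nodes (right_spine (t # ts)) \<longleftrightarrow> z = [] \<or> (\<exists>y\<in>nodes t. z = L # y) \<or>
      (\<exists>y\<in>nodes (right_spine ts). z = R # y)"
    by auto
  moreover have "(\<exists>y\<in>nodes (right_spine ts). z = R # y) \<longleftrightarrow>
      (\<exists>n\<le>length ts. z = replicate (Suc n) R) \<or>
      (\<exists>n<length ts. \<exists>y\<in>nodes ((t # ts) ! Suc n). z = replicate (Suc n) R @ L # y)"
    unfolding Bex_def Cons.IH nth_Cons_Suc replicate_Suc append_Cons by blast
  ultimately show ?case
    unfolding list.size(4) add_Suc_right add_0_right * Ex_less_Suc2
    by (simp only: replicate_0 append_Nil nth_Cons_0 disj_ac)
qed auto

section \<open>Clusters and merges\<close>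

text \<open>
  A cluster is represented by the set \<open>V\<close> of lower endpoints of its edges. If it has no bottom boundary
  node, then \<open>b\<close> is any vertex outside \<open>V\<close>.
\<close>

definition vertex_cluster :: "'a tree \<Rightarrow> node set \<Rightarrow> node \<Rightarrow> node \<Rightarrow> bool" where
  "vertex_cluster T V r b \<longleftrightarrow>
     V \<subseteq> nodes T \<and>
     (\<forall>v\<in>V. strict_prefix r v) \<and>
     (\<forall>v\<in>V. \<forall>z. strict_prefix r z \<longrightarrow> prefix z v \<longrightarrow> z \<in> V) \<and>
     (\<forall>v\<in>V. v \<noteq> b \<longrightarrow> (\<forall>d. v @ [d] \<in> nodes T \<longrightarrow> v @ [d] \<in> V)) \<and>
     (b \<in> V \<longrightarrow> (\<forall>d. b @ [d] \<notin> V))"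

lemma vertex_cluster_of_cluster:
  assumes "cluster T C r B"
  shows "\<exists>b. vertex_cluster T (snd ` C) r b"
proof -
  have sub: "C \<subseteq> edges T"
    and reach: "\<And>v. v \<in> Field C \<Longrightarrow> (r, v) \<in> C\<^sup>*"
    and bottom: "set_option B \<subseteq> Field C - Domain C"
    and inner: "\<And>v w. v \<in> Field C \<Longrightarrow> (v, w) \<in> edges T \<Longrightarrow> w \<notin> Field C \<Longrightarrow>
      v = r \<or> v \<in> set_option B"
    using assms unfolding cluster_def by blast+
  have step: "\<exists>d. v = u @ [d]" if "(u, v) \<in> C" for u v
    using that sub edgesD by blast
  have pre: "prefix r v" if "(r, v) \<in> C\<^sup>*" for v
    using that by induction (auto dest!: step)
  have strict: "strict_prefix r v" if "v \<in> snd ` C" for v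
  proof -
    from that obtain u where u: "(u, v) \<in> C" by auto
    then have "prefix r u" using pre reach by (auto simp: Field_def)
    then show ?thesis using step[OF u] by (auto simp: strict_prefix_def prefix_def)
  qed
  have path: "z \<in> snd ` C" if "(r, v) \<in> C\<^sup>*" "strict_prefix r z" "prefix z v" for v z
    using that
  proof (induction arbitrary: z)
    case (step y v)
    then show ?case using \<open>\<And>v u. (u, v) \<in> C \<Longrightarrow> \<exists>d. v = u @ [d]\<close>[OF step.hyps(2)]
      by (force simp: prefix_snoc)
  qed (auto dest: prefix_order.less_le_trans)
  \<comment> \<open>Without a bottom boundary node, \<open>[]\<close> serves as \<open>b\<close>:
    the root of the whole tree is never the lower endpoint of an edge.\<close>
  define b where "b = (case B of None \<Rightarrow> [] | Some b \<Rightarrow> b)"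
  have children: "v @ [d] \<in> snd ` C" if v: "v \<in> snd ` C" "v \<noteq> b" "v @ [d] \<in> nodes T" for v d
  proof -
    have "v \<in> Field C" "v \<noteq> r" using v(1) strict by (auto simp: Field_def)
    moreover have "v \<notin> set_option B" using v(2) by (cases B) (auto simp: b_def)
    ultimately have "v @ [d] \<in> Field C" using inner edgesI[OF v(3)] by blast
    moreover have "strict_prefix r (v @ [d])"
      using strict[OF v(1)] by (auto simp: strict_prefix_def prefix_def)
    ultimately show ?thesis using path reach by blast
  qed
  have bottom_leaf: False if b: "b \<in> snd ` C" "b @ [d] \<in> snd ` C" for d
  proof (cases B)
    case None
    then show False using strict[OF b(1)] by (simp add: b_def)
  next
    case (Some b')
    obtain u where u: "(u, b @ [d]) \<in> C" using b(2) by auto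
    then have "u = b" using step[OF u] by simp
    then show False using u bottom Some by (auto simp: b_def)
  qed
  have sub_nodes: "snd ` C \<subseteq> nodes T" 
  proof
    fix v assume "v \<in> snd ` C"
    then obtain u where "(u, v) \<in> C" by auto
    then show "v \<in> nodes T" using sub edgesD by blast
  qed
  have upwards: "z \<in> snd ` C" if "v \<in> snd ` C" "strict_prefix r z" "prefix z v" for v z
  proof -
    have "v \<in> Field C" using that(1) by (auto simp: Field_def)
    then show ?thesis using path[OF reach] that by blast
  qed
  have "vertex_cluster T (snd ` C) r b"
    unfolding vertex_cluster_def
    by (intro conjI ballI allI impI notI)
      (rule sub_nodes strict children bottom_leaf upwards; assumption)+
  then show ?thesis ..
qed

section \<open>Shape of a cluster with one root and one bottom\<close>

context
  fixes T :: "'a tree" and V r b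
  assumes V: "vertex_cluster T V r b"
begin

lemma vertex_cluster_nodes: "V \<subseteq> nodes T"
  using V unfolding vertex_cluster_def by blast

lemma vertex_cluster_root: "v \<in> V \<Longrightarrow> strict_prefix r v"
  using V unfolding vertex_cluster_def by blast

lemma vertex_cluster_path: "v \<in> V \<Longrightarrow> strict_prefix r z \<Longrightarrow> prefix z v \<Longrightarrow> z \<in> V"
  using V unfolding vertex_cluster_def by blast

lemma vertex_cluster_convex:
  assumes "u \<in> V" "w \<in> V" "prefix u z" "prefix z w"
  shows "z \<in> V"
  using vertex_cluster_path[OF assms(2) _ assms(4)] vertex_cluster_root[OF assms(1)] assms(3)
  by (meson prefix_order.less_le_trans)

lemma vertex_cluster_sibling:
  assumes "v \<in> V" "v @ [d] \<in> V" "v @ [d'] \<in> nodes T"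
  shows "v @ [d'] \<in> V"
  using V assms unfolding vertex_cluster_def by metis

text \<open>A walk downwards from \<open>v\<close> can leave the cluster only at \<open>b\<close>,
  which does not lie under \<open>v\<close>.\<close>

lemma vertex_cluster_below:
  assumes "v \<in> V" "\<not> prefix v b" "prefix v z" "z \<in> nodes T"
  shows "z \<in> V"
proof -
  from assms(3) obtain q where z: "z = v @ q" by (auto simp: prefix_def)
  have "v @ q \<in> nodes T \<Longrightarrow> v @ q \<in> V"
  proof (induction q rule: rev_induct)
    case (snoc d q)
    then have "v @ q \<in> V" using nodes_butlast[of "v @ q" d T] by simp
    moreover have "v @ q \<noteq> b" using assms(2) by auto
    ultimately have "(v @ q) @ [d] \<in> V"
      using V snoc.prems unfolding vertex_cluster_def by (metis append_assoc)
    then show ?case by simp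
  qed (simp add: assms)
  then show ?thesis using assms z by simp
qed

text \<open>The vertex \<open>b\<close> lies in at most one of the two branches at \<open>v\<close>,
  so the other one is contained completely. Which one that is remains unknown.\<close>

lemma vertex_cluster_full_branch:
  assumes "v \<in> V" "v @ [d] \<in> V"
  shows "\<exists>d'. \<forall>z\<in>nodes T. prefix (v @ [d']) z \<longrightarrow> z \<in> V"
proof -
  have "\<not> prefix (v @ [L]) b \<or> \<not> prefix (v @ [R]) b" by (auto simp: prefix_def)
  then obtain d' where d': "\<not> prefix (v @ [d']) b" by blast
  have "z \<in> V" if z: "z \<in> nodes T" "prefix (v @ [d']) z" for z
  proof -
    have "v @ [d'] \<in> nodes T" using z nodes_append unfolding prefix_def by blast
    then have "v @ [d'] \<in> V" using vertex_cluster_sibling assms by blast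
    then show ?thesis using vertex_cluster_below d' z by blast
  qed
  then show ?thesis by blast
qed

lemma vertex_cluster_bottom_below:
  assumes "e \<in> V" "f \<notin> V" "f \<in> nodes T" "prefix e f"
  shows "prefix e b"
  using vertex_cluster_below assms by blast

text \<open>The path from the cluster root \<open>r\<close> down to \<open>f\<close> avoids
  \<open>e\<close>, although \<open>e\<close> is above \<open>f\<close>. So \<open>r\<close> is at
  or below \<open>e\<close>, and with it the whole cluster.\<close>

lemma vertex_cluster_root_below:
  assumes "e \<notin> V" "f \<in> V" "prefix e f" "v \<in> V"
  shows "prefix e v"
proof -
  have "\<not> strict_prefix r e" using vertex_cluster_path assms by blast
  moreover have "prefix r f" using vertex_cluster_root[OF assms(2)] by simp
  ultimately have "prefix e r"
    using assms(3) prefix_same_cases by (metis prefix_order.le_neq_trans prefix_order.refl)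
  then show ?thesis using vertex_cluster_root[OF assms(4)]
    by (meson prefix_order.le_less_trans prefix_order.less_imp_le)
qed

text \<open>\<open>K\<close> is the last index for which both \<open>v K\<close> and its
  \<open>d\<close>-child belong to the cluster. A member strictly below \<open>v (Suc K)\<close>
  would, by convexity and the sibling property, bring in \<open>v (Suc K)\<close> and its
  \<open>d\<close>-child, contradicting maximality.\<close>

lemma vertex_cluster_deepest:
  fixes v :: "nat \<Rightarrow> node"
  assumes mono: "\<And>k l. k \<le> l \<Longrightarrow> prefix (v k) (v l)"
    and child: "\<And>k. k < m \<Longrightarrow> v k @ [d] \<in> nodes T"
    and k: "k < m" "v k \<in> V" "v k @ [d] \<in> V"
  shows "\<exists>K<m. v K \<in> V \<and> (\<exists>d'. \<forall>z\<in>nodes T. prefix (v K @ [d']) z \<longrightarrow> z \<in> V) \<and>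
    (Suc K < m \<longrightarrow> (\<forall>z\<in>V. \<not> strict_prefix (v (Suc K)) z))"
proof -
  let ?A = "{k. k < m \<and> v k \<in> V \<and> v k @ [d] \<in> V}"
  define K where "K = Max ?A"
  have fin: "finite ?A" by simp
  have K: "K \<in> ?A" unfolding K_def by (rule Max_in[OF fin]) (use k in blast)
  have kK: "k \<le> K" unfolding K_def by (rule Max_ge[OF fin]) (use k in blast)
  have "\<not> strict_prefix (v (Suc K)) z" if "Suc K < m" "z \<in> V" for z
  proof
    assume sp: "strict_prefix (v (Suc K)) z"
    then have "prefix (v (Suc K)) z" by simp
    then have vS: "v (Suc K) \<in> V"
      using vertex_cluster_convex[OF k(2) that(2) mono] kK by simp
    from sp obtain d' q where "z = (v (Suc K) @ [d']) @ q"
      by (auto elim!: strict_prefixE')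
    then have "v (Suc K) @ [d'] \<in> V"
      using vertex_cluster_convex[OF vS that(2), of "v (Suc K) @ [d']"] by simp
    then have "v (Suc K) @ [d] \<in> V" using vertex_cluster_sibling vS child that by blast
    then have "Suc K \<in> ?A" using that vS by blast
    then have "Suc K \<le> K" unfolding K_def by (rule Max_ge[OF fin])
    then show False by simp
  qed
  then show ?thesis using K vertex_cluster_full_branch by blast
qed

end

section \<open>Label trees and the family of merges\<close>

lemma top_tree_of_edges: "top_tree_of T C t \<Longrightarrow> C \<subseteq> edges T"
  by (induction rule: top_tree_of.induct) auto

lemma inj_on_snd_edges: "inj_on snd (edges T)"
  by (auto simp: inj_on_def edges_def)

lemma finite_edges: "finite (edges T)"
  by (rule finite_imageD[OF finite_subset[OF _ finite_nodes[of T]] inj_on_snd_edges])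
    (auto simp: edges_def)

lemma snd_disjoint:
  assumes "C1 \<subseteq> edges T" "C2 \<subseteq> edges T" "C1 \<inter> C2 = {}"
  shows "snd ` C1 \<inter> snd ` C2 = {}"
  using inj_on_image_Int[OF inj_on_snd_edges, of C1 T C2] assms by simp

lemma card_last_union:
  assumes "C1 \<subseteq> edges T" "C2 \<subseteq> edges T" "C1 \<inter> C2 = {}"
  shows "card {v \<in> snd ` (C1 \<union> C2). last v = d} =
    card {v \<in> snd ` C1. last v = d} + card {v \<in> snd ` C2. last v = d}"
proof -
  have "finite (snd ` C1)" "finite (snd ` C2)"
    using assms finite_edges[of T] by (auto intro: finite_subset)
  moreover have "{v \<in> snd ` (C1 \<union> C2). last v = d} =
    {v \<in> snd ` C1. last v = d} \<union> {v \<in> snd ` C2. last v = d}" by auto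
  ultimately show ?thesis using snd_disjoint[OF assms] by (simp add: card_Un_disjoint disjoint_iff)
qed

text \<open>The last entry of a lower endpoint is the direction of its edge, and merges unite
  disjoint edge sets. So identical label trees force equal numbers of left and of right
  edges.\<close>

lemma card_last_top_tree:
  "top_tree_of T C t \<Longrightarrow> card {v \<in> snd ` C. last v = d} = count_list (inorder t) (Edge d)"
proof (induction rule: top_tree_of.induct)
  case (single_edge p d')
  have "{v \<in> snd ` {(p, p @ [d'])}. last v = d} = (if d' = d then {p @ [d']} else {})" by auto
  then show ?case by simp
next
  case (horizontal_merge C1 t1 C2 t2 r B1 B2 r' B)
  then show ?case using card_last_union[of C1 T C2 d] top_tree_of_edges by fastforce
next
  case (vertical_merge C1 t1 C2 t2 v B1 r r' B)
  then show ?case using card_last_union[of C1 T C2 d] top_tree_of_edges by fastforce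
qed

text \<open>A merge is recorded as the pair of merged clusters and the top-tree node it creates.\<close>

definition joined :: "node set \<times> node set \<times> label tree \<Rightarrow> node set" where
  "joined x = (case x of (V1, V2, t) \<Rightarrow> V1 \<union> V2)"

text \<open>For a merge in the top-tree this says that the joined cluster is the smallest one
  containing both edges.\<close>

definition separates :: "node set \<times> node set \<times> label tree \<Rightarrow> node \<Rightarrow> node \<Rightarrow> bool" where
  "separates x e f \<longleftrightarrow> (case x of (V1, V2, t) \<Rightarrow> e \<in> V1 \<and> f \<in> V2 \<or> e \<in> V2 \<and> f \<in> V1)"

definition vertex_merge :: "'a tree \<Rightarrow> node set \<times> node set \<times> label tree \<Rightarrow> bool" where
  "vertex_merge T x \<longleftrightarrow> (case x of (V1, V2, t) \<Rightarrow> V1 \<inter> V2 = {} \<and>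
     (\<exists>r b. vertex_cluster T V1 r b) \<and> (\<exists>r b. vertex_cluster T V2 r b) \<and>
     (\<exists>r b. vertex_cluster T (V1 \<union> V2) r b) \<and>
     (\<forall>d. card {v \<in> V1 \<union> V2. last v = d} = count_list (inorder t) (Edge d)))"

text \<open>This collects what the counting needs from a top-tree: its merges form a laminar family,
  and any two distinct edges are brought together by one of them. Repeated occurrences of the same
  label tree stay apart, since each record also holds its clusters.\<close>

definition merge_family ::
  "'a tree \<Rightarrow> (node \<times> node) set \<Rightarrow> label tree \<Rightarrow> (node set \<times> node set \<times> label tree) set \<Rightarrow> bool" where
  "merge_family T C t F \<longleftrightarrow>
     (\<forall>x\<in>F. vertex_merge T x \<and> joined x \<subseteq> snd ` C \<and> snd (snd x) \<in> subtrees t - {\<langle>\<rangle>}) \<and>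
     (\<forall>x\<in>F. \<forall>y\<in>F. x = y \<or> joined x \<subset> joined y \<or> joined y \<subset> joined x \<or>
        joined x \<inter> joined y = {}) \<and>
     (\<forall>e\<in>snd ` C. \<forall>f\<in>snd ` C. e \<noteq> f \<longrightarrow> (\<exists>x\<in>F. separates x e f))"

lemma merge_familyD:
  assumes "merge_family T C t F" "x \<in> F"
  shows "vertex_merge T x" "joined x \<subseteq> snd ` C" "snd (snd x) \<in> subtrees t" "snd (snd x) \<noteq> \<langle>\<rangle>"
  using assms by (simp_all add: merge_family_def)

lemma merge_family_laminar:
  assumes "merge_family T C t F" "x \<in> F" "y \<in> F"
  shows "x = y \<or> joined x \<subset> joined y \<or> joined y \<subset> joined x \<or> joined x \<inter> joined y = {}"
  using assms by (simp add: merge_family_def)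

lemma merge_family_separates:
  assumes "merge_family T C t F" "e \<in> snd ` C" "f \<in> snd ` C" "e \<noteq> f"
  shows "\<exists>x\<in>F. separates x e f"
  using assms(1)[unfolded merge_family_def, THEN conjunct2, THEN conjunct2] assms(2-) by blast

lemma merge_family_join:
  fixes T :: "'a tree"
  assumes t: "top_tree_of T C1 t1" "top_tree_of T C2 t2" "top_tree_of T (C1 \<union> C2) \<langle>t1, a, t2\<rangle>"
    and disj: "C1 \<inter> C2 = {}"
    and cl: "cluster T C1 r1 B1" "cluster T C2 r2 B2" "cluster T (C1 \<union> C2) r B"
    and F1: "merge_family T C1 t1 F1" and F2: "merge_family T C2 t2 F2"
  shows "merge_family T (C1 \<union> C2) \<langle>t1, a, t2\<rangle>
    (insert (snd ` C1, snd ` C2, \<langle>t1, a, t2\<rangle>) (F1 \<union> F2))"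
proof -
  let ?x = "(snd ` C1, snd ` C2, \<langle>t1, a, t2\<rangle>)"
  have d: "snd ` C1 \<inter> snd ` C2 = {}"
    by (rule snd_disjoint[OF top_tree_of_edges[OF t(1)] top_tree_of_edges[OF t(2)] disj])
  have ne: "snd ` C1 \<noteq> {}" "snd ` C2 \<noteq> {}"
    using cl by (simp_all add: cluster_def)
  have jx: "joined ?x = snd ` C1 \<union> snd ` C2" by (simp add: joined_def)
  have merge: "vertex_merge T ?x"
    unfolding vertex_merge_def prod.case image_Un[symmetric]
    using d vertex_cluster_of_cluster[OF cl(1)] vertex_cluster_of_cluster[OF cl(2)]
      vertex_cluster_of_cluster[OF cl(3)] card_last_top_tree[OF t(3)]
    by (intro conjI) blast+
  have sub1: "joined y \<subseteq> snd ` C1" if "y \<in> F1" for y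
    using merge_familyD(2)[OF F1 that] .
  have sub2: "joined y \<subseteq> snd ` C2" if "y \<in> F2" for y
    using merge_familyD(2)[OF F2 that] .
  \<comment> \<open>Both merged parts are nonempty and disjoint, so every earlier cluster misses an
    edge of the new one.\<close>
  have subx: "joined y \<subset> joined ?x" if "y \<in> F1 \<union> F2" for y
  proof -
    have "joined y \<subseteq> snd ` C1 \<or> joined y \<subseteq> snd ` C2" using that sub1 sub2 by blast
    then show ?thesis using d ne unfolding jx by blast
  qed
  have disj': "joined x \<inter> joined y = {}" if "x \<in> F1" "y \<in> F2" for x y
    using sub1[OF that(1)] sub2[OF that(2)] d by blast
  have lam: "x = y \<or> joined x \<subset> joined y \<or> joined y \<subset> joined x \<or> joined x \<inter> joined y = {}"
    if xy: "x \<in> insert ?x (F1 \<union> F2)" "y \<in> insert ?x (F1 \<union> F2)" for x y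
  proof -
    consider "x = y" | "x = ?x" "y \<in> F1 \<union> F2" | "x \<in> F1 \<union> F2" "y = ?x"
      | "x \<in> F1" "y \<in> F1" | "x \<in> F2" "y \<in> F2" | "x \<in> F1" "y \<in> F2" | "x \<in> F2" "y \<in> F1"
      using xy by blast
    then show ?thesis
    proof cases
      case 2 then show ?thesis using subx by simp
    next
      case 3 then show ?thesis using subx by simp
    next
      case 4 then show ?thesis by (rule merge_family_laminar[OF F1])
    next
      case 5 then show ?thesis by (rule merge_family_laminar[OF F2])
    next
      case 6 then show ?thesis using disj' by simp
    next
      case 7 then show ?thesis using disj'[of y x] by (simp add: Int_commute)
    qed simp
  qed
  have sep: "\<exists>x\<in>insert ?x (F1 \<union> F2). separates x e f"
    if ef: "e \<in> snd ` (C1 \<union> C2)" "f \<in> snd ` (C1 \<union> C2)" "e \<noteq> f" for e f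
  proof -
    consider "e \<in> snd ` C1" "f \<in> snd ` C1" | "e \<in> snd ` C2" "f \<in> snd ` C2" | "separates ?x e f"
      using ef(1,2) unfolding image_Un separates_def prod.case by blast
    then show ?thesis
    proof cases
      case 1 then show ?thesis using merge_family_separates[OF F1 _ _ ef(3)] by blast
    next
      case 2 then show ?thesis using merge_family_separates[OF F2 _ _ ef(3)] by blast
    qed simp
  qed
  have all: "vertex_merge T y \<and> joined y \<subseteq> snd ` (C1 \<union> C2) \<and>
      snd (snd y) \<in> subtrees \<langle>t1, a, t2\<rangle> - {\<langle>\<rangle>}" if y: "y \<in> insert ?x (F1 \<union> F2)" for y
  proof -
    consider "y = ?x" | "y \<in> F1" | "y \<in> F2" using y by blast
    then show ?thesis
    proof cases
      case 1
      then show ?thesis using merge jx by (simp add: image_Un)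
    next
      case 2
      then show ?thesis using merge_familyD[OF F1 2] by auto
    next
      case 3
      then show ?thesis using merge_familyD[OF F2 3] by auto
    qed
  qed
  show ?thesis
    unfolding merge_family_def by (intro conjI ballI impI all lam sep)
qed

lemma merge_family_exists: "top_tree_of T C t \<Longrightarrow> \<exists>F. merge_family T C t F"
proof (induction rule: top_tree_of.induct)
  case (single_edge p d)
  have "merge_family T {(p, p @ [d])} \<langle>\<langle>\<rangle>, Edge d, \<langle>\<rangle>\<rangle> {}" by (simp add: merge_family_def)
  then show ?case ..
next
  case (horizontal_merge C1 t1 C2 t2 r B1 B2 r' B)
  then show ?case
    using merge_family_join top_tree_of.horizontal_merge by metis
next
  case (vertical_merge C1 t1 C2 t2 v B1 r r' B)
  then show ?case
    using merge_family_join top_tree_of.vertical_merge by metis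
qed

lemma vertex_merge_finite: "vertex_merge T x \<Longrightarrow> finite (joined x)"
  unfolding vertex_merge_def joined_def
  using finite_subset[OF vertex_cluster_nodes finite_nodes] by (cases x) auto

lemma vertex_merge_card:
  assumes "vertex_merge T x"
  shows "card {v \<in> joined x. last v = d} = count_list (inorder (snd (snd x))) (Edge d)"
  using assms by (cases x) (simp add: vertex_merge_def joined_def del: Un_iff)

lemma card_joined:
  assumes "vertex_merge T x"
  shows "card (joined x) = card {v \<in> joined x. last v = L} + card {v \<in> joined x. last v = R}"
proof -
  have "joined x = {v \<in> joined x. last v = L} \<union> {v \<in> joined x. last v = R}"
    using dir.exhaust by auto
  moreover have "{v \<in> joined x. last v = L} \<inter> {v \<in> joined x. last v = R} = {}" by auto
  ultimately show ?thesis
    using vertex_merge_finite[OF assms] by (metis (no_types, lifting) card_Un_disjoint finite_Un)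
qed

text \<open>Equal label trees give clusters of equal size. Intersecting clusters are nested, and a
  proper inclusion would change the size.\<close>

lemma merge_family_determined:
  assumes F: "merge_family T C t F" "x \<in> F" "y \<in> F"
    and t: "snd (snd x) = snd (snd y)"
    and meet: "joined x \<inter> joined y \<noteq> {}"
  shows "x = y"
proof -
  have vm: "vertex_merge T x" "vertex_merge T y"
    using merge_familyD(1)[OF F(1)] F(2,3) by auto
  have "card (joined x) = card (joined y)"
    unfolding card_joined[OF vm(1)] card_joined[OF vm(2)]
      vertex_merge_card[OF vm(1)] vertex_merge_card[OF vm(2)] t ..
  then have "\<not> joined x \<subset> joined y" "\<not> joined y \<subset> joined x"
    using psubset_card_mono[OF vertex_merge_finite[OF vm(1)]]
      psubset_card_mono[OF vertex_merge_finite[OF vm(2)]] by (metis less_irrefl)+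
  then show ?thesis using merge_family_laminar[OF F] meet by blast
qed

text \<open>The symmetry of the two parts is used up once and for all: \<open>V\<close> is the part
  of \<open>e\<close>, \<open>V'\<close> that of \<open>f\<close>.\<close>

lemma separates_cases:
  assumes "vertex_merge T x" "separates x e f"
  obtains V V' r b r' b' where "joined x = V \<union> V'" "V \<inter> V' = {}" "e \<in> V" "f \<in> V'"
    "vertex_cluster T V r b" "vertex_cluster T V' r' b'"
    "\<And>e' f'. separates x e' f' \<longleftrightarrow> e' \<in> V \<and> f' \<in> V' \<or> e' \<in> V' \<and> f' \<in> V"
proof -
  obtain V1 V2 t where x: "x = (V1, V2, t)" by (cases x)
  obtain r1 b1 r2 b2 where V: "V1 \<inter> V2 = {}" "vertex_cluster T V1 r1 b1" "vertex_cluster T V2 r2 b2"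
    using assms(1) unfolding x vertex_merge_def prod.case by blast
  have sep: "separates x e' f' \<longleftrightarrow> e' \<in> V1 \<and> f' \<in> V2 \<or> e' \<in> V2 \<and> f' \<in> V1" for e' f'
    by (simp add: x separates_def)
  have j: "joined x = V1 \<union> V2" "joined x = V2 \<union> V1" by (auto simp: x joined_def)
  consider "e \<in> V1" "f \<in> V2" | "e \<in> V2" "f \<in> V1" using assms(2) sep by blast
  then show thesis
  proof cases
    case 1
    show thesis by (rule that[OF j(1) V(1) 1 V(2,3) sep])
  next
    case 2
    have "V2 \<inter> V1 = {}" using V(1) by blast
    then show thesis by (rule that[OF j(2) _ 2 V(3,2)]) (simp only: sep disj_commute)
  qed
qed

text \<open>One of \<open>e'\<close> and \<open>f'\<close> lies in the part of \<open>e\<close>.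
  Convexity then puts \<open>f\<close>, which is between them, into that part too. So different
  levels of one block have different merges.\<close>

lemma separates_unique:
  assumes x: "vertex_merge T x" "separates x e f" "separates x e' f'"
    and pre: "prefix e f" "prefix f e'" "prefix e' f'"
  shows False
proof -
  obtain V V' r b where V: "V \<inter> V' = {}" "e \<in> V" "f \<in> V'" "vertex_cluster T V r b"
      and "e' \<in> V \<or> f' \<in> V"
    using separates_cases[OF x(1,2)] x(3) by (metis (no_types, lifting))
  moreover have "prefix f f'" using pre prefix_order.trans by blast
  ultimately have "f \<in> V"
    using vertex_cluster_convex[OF V(4,2) _ pre(1)] pre(2) by blast
  then show False using V by blast
qed

text \<open>The part containing \<open>f\<close> misses \<open>e\<close>, so it lies below
  \<open>e\<close>; it also contains \<open>e'\<close> or \<open>f'\<close>. This is how a merge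
  reveals its block.\<close>

lemma separates_lower_part:
  assumes x: "vertex_merge T x" "separates x e f" "separates x e' f'" and pre: "prefix e f"
  shows "prefix e e' \<or> prefix e f'"
proof -
  obtain V V' r b where V: "V \<inter> V' = {}" "e \<in> V" "f \<in> V'" "vertex_cluster T V' r b"
      and "e' \<in> V' \<or> f' \<in> V'"
    using separates_cases[OF x(1,2)] x(3) by (metis (no_types, lifting))
  moreover have "e \<notin> V'" using V by blast
  ultimately show ?thesis
    using vertex_cluster_root_below[OF V(4) _ V(3) pre] by blast
qed

lemma nodes_in_snd_edges: "v \<in> nodes T \<Longrightarrow> v \<noteq> [] \<Longrightarrow> v \<in> snd ` edges T"
  by (cases v rule: rev_cases) (auto intro!: image_eqI[OF _ edgesI])

section \<open>Edge counts inside a block\<close>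

lemma replicate_branch_eq_iff:
  "replicate n R @ L # y = replicate n' R @ L # y' \<longleftrightarrow> n = n' \<and> y = y'"
proof (induction n arbitrary: n')
  case 0
  then show ?case by (cases n') auto
next
  case (Suc n)
  then show ?case by (cases n') auto
qed

lemma card_nodes_comb: "card (nodes (comb w)) \<le> 2 * w"
proof -
  have "card (nodes (comb w)) \<le> card ((\<lambda>i. replicate i R) ` {..<w})
      + card ((\<lambda>i. replicate i R @ [L]) ` {..<w})"
    unfolding nodes_comb by (rule card_Un_le)
  also have "\<dots> \<le> card {..<w} + card {..<w}"
    by (intro add_mono card_image_le) auto
  finally show ?thesis by simp
qed

lemma card_nodes_right_path: "card (nodes (right_path w)) \<le> w"
  unfolding nodes_right_path using card_image_le[of "{..<w}"] by simp

lemma card_UN_le_sum: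
  assumes "finite I" "\<And>i. i \<in> I \<Longrightarrow> card (A i) \<le> h i"
  shows "card (\<Union>i\<in>I. A i) \<le> sum h I"
  using card_UN_le[OF assms(1), of A] sum_mono[of I "\<lambda>i. card (A i)" h] assms(2) by fastforce

lemma le_card_if_inj:
  assumes "finite V" "inj h" "\<And>i. i < w \<Longrightarrow> h i \<in> V"
  shows "(w::nat) \<le> card V"
  using card_inj_on_le[of h "{..<w}" V] assms by (auto intro: inj_on_subset)

lemma sum_geometric_le:
  fixes c p :: nat
  assumes "0 < p"
  shows "(\<Sum>l\<le>K. 8 ^ (c + p * l)) \<le> 2 * (8::nat) ^ (c + p * K)"
proof (induction K)
  case (Suc K)
  have "2 * (8::nat) ^ (c + p * K) \<le> 8 ^ (p + (c + p * K))"
    unfolding power_add[of 8 p] using assms by (intro mult_right_mono) (cases p, auto)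
  then show ?case using Suc by (simp add: ac_simps)
qed simp

lemma power_interval_unique:
  fixes c :: nat
  assumes "8 ^ a \<le> c" "c < 8 ^ Suc a" "8 ^ b \<le> c" "c < 8 ^ Suc b"
  shows "a = b"
proof -
  have "(8::nat) ^ a < 8 ^ Suc b" "(8::nat) ^ b < 8 ^ Suc a"
    using assms le_less_trans by blast+
  then have "a < Suc b" "b < Suc a"
    by (simp_all only: power_strict_increasing_iff numeral_less_iff one_less_numeral_iff num.simps semiring_norm)
  then show ?thesis by simp
qed

text \<open>The exponents of the sizes have the level as high digit and a block coordinate as low
  digit in base \<open>p\<close>.\<close>

lemma digits_unique:
  fixes p :: nat
  assumes "p * K + i = p * K' + i'" "i < p" "i' < p"
  shows "K = K' \<and> i = i'"
proof -
  have "(p * K + i) div p = K" "(p * K' + i') div p = K'" using assms(2,3) by auto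
  then show ?thesis using assms(1) by auto
qed

lemma prefix_zig_R: "k \<le> l \<Longrightarrow> prefix (zig k @ [R]) (zig l @ [R])"
  by (induction rule: dec_induct) (auto simp: zig_Suc_snoc intro: prefix_order.trans)

section \<open>The hard tree and the sizes of its hanging parts\<close>

context
  fixes m p :: nat
  assumes m_pos: "0 < m" and m_le_p: "m \<le> p"
begin

text \<open>
  The zigzag has levels \<open>0, \<dots>, m\<close>, and the last two have equal sizes. So at each level \<open>k < m\<close> either
  branch of the tree contains a comb (and a path) at least as large as the one of level \<open>k\<close>, which
  matters because a bottom boundary node can truncate one of the branches arbitrarily.
\<close>

definition comb_size :: "nat \<Rightarrow> nat \<Rightarrow> nat" where
  "comb_size n k = 8 ^ (m + n div p + p * min k (m - 1))"

text \<open>The offset \<open>p * m\<close> makes every path of a block at least eight times as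
  large as its largest comb.\<close>

definition path_size :: "nat \<Rightarrow> nat \<Rightarrow> nat" where
  "path_size n k = 8 ^ (m + p * m + n mod p + p * min k (m - 1))"

definition block :: "nat \<Rightarrow> unit tree" where
  "block n = zigzag (comb_size n) (path_size n) 0 (Suc m)"

definition tree :: "unit tree" where
  "tree = right_spine (map block [0..<p * p])"

definition root :: "nat \<Rightarrow> node" where
  "root n = replicate n R @ [L]"

text \<open>This is the even zigzag vertex of level \<open>k\<close>; as a lower endpoint it stands
  for the edge into that level.\<close>

definition key :: "nat \<Rightarrow> nat \<Rightarrow> node" where
  "key n k = root n @ zig k"

lemma p_pos: "0 < p" using m_pos m_le_p by simp

text \<open>The index set consists of the levels whose hanging parts a cluster with deepest level
  \<open>K\<close> can touch. The geometric sum costs a factor 2, and the duplicated last level,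
  present when \<open>Suc K = m\<close>, adds one more top term.\<close>

lemma sum_levels_le:
  assumes "K < m"
  shows "(\<Sum>l\<in>{l. l \<le> m \<and> (l \<le> K \<or> Suc K = m)}. 8 ^ (c + p * min l (m - 1))) \<le> 3 * (8::nat) ^ (c + p * K)"
proof -
  let ?h = "\<lambda>l. (8::nat) ^ (c + p * min l (m - 1))"
  have "(\<Sum>l\<le>K. ?h l) = (\<Sum>l\<le>K. 8 ^ (c + p * l))"
    using assms by (intro sum.cong) (auto simp: min_def)
  then have K: "(\<Sum>l\<le>K. ?h l) \<le> 2 * 8 ^ (c + p * K)"
    using sum_geometric_le[OF p_pos, of c K] by simp
  show ?thesis
  proof (cases "Suc K = m")
    case True
    then have "{l. l \<le> m \<and> (l \<le> K \<or> Suc K = m)} = {..Suc K}" by auto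
    moreover have "?h (Suc K) = 8 ^ (c + p * K)"
      using True by (intro arg_cong[where f = "\<lambda>l. 8 ^ (c + p * l)"]) auto
    ultimately show ?thesis using K by (simp only: sum.atMost_Suc)
  next
    case False
    then have "{l. l \<le> m \<and> (l \<le> K \<or> Suc K = m)} = {..K}" using assms by auto
    then show ?thesis using K by simp
  qed
qed

lemma node_in_tree: "n < p * p \<Longrightarrow> y \<in> nodes (block n) \<Longrightarrow> root n @ y \<in> nodes tree"
  unfolding tree_def nodes_right_spine root_def by (intro disjI2 exI[of _ n]) auto

lemma spine_in_tree: "n \<le> p * p \<Longrightarrow> replicate n R \<in> nodes tree"
  unfolding tree_def nodes_right_spine by (intro disjI1 exI[of _ n]) auto

lemma node_below_root:
  assumes "z \<in> nodes tree" "prefix (root n) z"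
  shows "\<exists>y\<in>nodes (block n). z = root n @ y"
proof -
  obtain y where y: "z = replicate n R @ L # y" using assms(2) by (auto simp: prefix_def root_def)
  have "L \<in> set z" by (simp add: y)
  then have "z \<noteq> replicate n' R" for n' by auto
  then obtain n' y' where n': "n' < p * p" "y' \<in> nodes (block n')" "z = replicate n' R @ L # y'"
    using assms(1) unfolding tree_def nodes_right_spine by auto
  then have "n = n'" "y = y'" using y replicate_branch_eq_iff by metis+
  then show ?thesis using n' by (auto simp: root_def)
qed

lemma key_Suc: "key n (Suc k) = (key n k @ [R]) @ [L]"
  by (simp add: key_def zig_Suc_snoc)

lemma prefix_key: "k \<le> l \<Longrightarrow> prefix (key n k) (key n l)"
  by (simp add: key_def prefix_zig)

lemma prefix_key_R: "k \<le> l \<Longrightarrow> prefix (key n k @ [R]) (key n l @ [R])"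
  using prefix_zig_R[of k l] unfolding key_def append_assoc same_prefix_prefix .

lemma prefix_root_key: "prefix (root n) (key n k)"
  by (simp add: key_def)

lemma block_nodes:
  "y \<in> nodes (block n) \<longleftrightarrow> (\<exists>l\<le>m. y = zig l \<or> y = zig l @ [R] \<or>
    (\<exists>c\<in>nodes (comb (comb_size n l)). y = zig l @ L # c) \<or>
    (\<exists>c\<in>nodes (right_path (path_size n l)). y = zig l @ R # R # c))"
  unfolding block_def nodes_zigzag less_Suc_eq_le add_0 ..

lemma block_cases:
  assumes "y \<in> nodes (block n)"
  obtains (key) l where "l \<le> m" "y = zig l"
  | (mid) l where "l \<le> m" "y = zig l @ [R]"
  | (comb) l c where "l \<le> m" "c \<in> nodes (comb (comb_size n l))" "y = zig l @ L # c"
  | (path) l c where "l \<le> m" "c \<in> nodes (right_path (path_size n l))" "y = zig l @ R # R # c"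
  using assms unfolding block_nodes by blast

lemma key_in_tree:
  assumes "n < p * p" "k \<le> m"
  shows "key n k \<in> nodes tree"
proof -
  have "zig k \<in> nodes (block n)" using assms(2) unfolding block_nodes by blast
  from node_in_tree[OF assms(1) this] show ?thesis by (simp add: key_def)
qed

lemma mid_in_tree:
  assumes "n < p * p" "k \<le> m"
  shows "key n k @ [R] \<in> nodes tree"
proof -
  have "zig k @ [R] \<in> nodes (block n)" using assms(2) unfolding block_nodes by blast
  from node_in_tree[OF assms(1) this] show ?thesis by (simp add: key_def)
qed

lemma comb_in_tree:
  assumes "n < p * p" "k \<le> m" "i < comb_size n k"
  shows "key n k @ L # replicate i R @ [L] \<in> nodes tree"
proof -
  have "replicate i R @ [L] \<in> nodes (comb (comb_size n k))" using assms(3) by (simp add: nodes_comb)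
  then have "zig k @ L # replicate i R @ [L] \<in> nodes (block n)"
    using assms(2) unfolding block_nodes by blast
  from node_in_tree[OF assms(1) this] show ?thesis by (simp add: key_def)
qed

lemma path_in_tree:
  assumes "n < p * p" "k \<le> m" "i < path_size n k"
  shows "key n k @ R # R # replicate i R \<in> nodes tree"
proof -
  have "replicate i R \<in> nodes (right_path (path_size n k))" using assms(3) by (simp add: nodes_right_path)
  then have "zig k @ R # R # replicate i R \<in> nodes (block n)"
    using assms(2) unfolding block_nodes by blast
  from node_in_tree[OF assms(1) this] show ?thesis by (simp add: key_def)
qed

lemma comb_size_mono: "k \<le> l \<Longrightarrow> comb_size n k \<le> comb_size n l"
  unfolding comb_size_def by (intro power_increasing add_left_mono mult_left_mono) auto

lemma path_size_mono: "k \<le> l \<Longrightarrow> path_size n k \<le> path_size n l"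
  unfolding path_size_def by (intro power_increasing add_left_mono mult_left_mono) auto

lemma m_less: "m < comb_size n k"
proof -
  have "m < 8 ^ m" by (rule power_gt_expt) simp
  also have "\<dots> \<le> comb_size n k" unfolding comb_size_def by (rule power_increasing) auto
  finally show ?thesis .
qed

context
  fixes V r b n
  assumes V: "vertex_cluster tree V r b" and inside: "\<And>v. v \<in> V \<Longrightarrow> prefix (root n) v"
    and n: "n < p * p"
begin

lemma cluster_finite: "finite V"
  using finite_subset[OF vertex_cluster_nodes[OF V] finite_nodes] .

lemma cluster_in_block: "v \<in> V \<Longrightarrow> \<exists>y\<in>nodes (block n). v = root n @ y"
  using node_below_root vertex_cluster_nodes[OF V] inside by blast

text \<open>Some branch at the deepest level \<open>K\<close> is complete and contains a comb of at
  least the size of level \<open>K\<close>. Conversely the combs within reach have at most 6 times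
  that size in vertices, and the even vertices add at most \<open>Suc m\<close>, which is no more
  than one comb.\<close>

lemma left_edges_bounds:
  assumes k: "k < m" "key n k \<in> V" "key n (Suc k) \<in> V"
  shows "\<exists>K<m. key n K \<in> V \<and> comb_size n K \<le> card {v \<in> V. last v = L} \<and>
    card {v \<in> V. last v = L} < 8 * comb_size n K"
proof -
  have "key n k @ [R] \<in> V"
    by (rule vertex_cluster_convex[OF V k(2,3)]) (auto simp: key_Suc)
  then obtain K d' where K: "K < m" "key n K \<in> V"
    and full: "\<And>z. z \<in> nodes tree \<Longrightarrow> prefix (key n K @ [d']) z \<Longrightarrow> z \<in> V"
    and deep: "\<And>z. Suc K < m \<Longrightarrow> z \<in> V \<Longrightarrow> \<not> strict_prefix (key n (Suc K)) z"
    using vertex_cluster_deepest[OF V, of "key n" m R k] prefix_key mid_in_tree[OF n] k(1,2)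
    by (metis less_imp_le)
  \<comment> \<open>The branch \<open>L\<close> holds the comb of level \<open>K\<close> itself; the
    branch \<open>R\<close> leads to level \<open>Suc K\<close>, whose comb is at least as
    large.\<close>
  define k' where "k' = (case d' of L \<Rightarrow> K | R \<Rightarrow> Suc K)"
  have k': "K \<le> k'" "k' \<le> m" using K by (auto simp: k'_def split: dir.splits)
  have low: "comb_size n K \<le> card {v \<in> V. last v = L}"
  proof (rule le_card_if_inj)
    show "inj (\<lambda>i. key n k' @ L # replicate i R @ [L])"
      by (rule injI) (auto dest: arg_cong[where f = length])
    fix i assume "i < comb_size n K"
    then have "key n k' @ L # replicate i R @ [L] \<in> nodes tree"
      using comb_in_tree[OF n] k' comb_size_mono less_le_trans by metis
    moreover have "prefix (key n K @ [d']) (key n k' @ L # replicate i R @ [L])"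
      by (cases d') (auto simp: k'_def key_Suc)
    ultimately show "key n k' @ L # replicate i R @ [L] \<in> {v \<in> V. last v = L}"
      using full by simp
  qed (simp add: cluster_finite)
  define I where "I = {l. l \<le> m \<and> (l \<le> K \<or> Suc K = m)}"
  have fin: "finite I" by (simp add: I_def)
  define A where "A l = (\<lambda>c. key n l @ L # c) ` nodes (comb (comb_size n l))" for l
  have "{v \<in> V. last v = L} \<subseteq> key n ` {..m} \<union> (\<Union>l\<in>I. A l)"
  proof
    fix v assume "v \<in> {v \<in> V. last v = L}"
    then have v: "v \<in> V" "last v = L" by auto
    obtain y where y: "y \<in> nodes (block n)" "v = root n @ y" using cluster_in_block[OF v(1)] by blast
    from y(1) show "v \<in> key n ` {..m} \<union> (\<Union>l\<in>I. A l)"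
    proof (cases rule: block_cases)
      case (key l)
      then show ?thesis using y(2) by (auto simp: key_def)
    next
      case (mid l)
      then show ?thesis using y(2) v(2) by simp
    next
      case (comb l c)
      have "\<not> (Suc K < m \<and> Suc K \<le> l)"
      proof
        assume *: "Suc K < m \<and> Suc K \<le> l"
        then have "prefix (key n (Suc K)) (key n l)" by (simp add: prefix_key)
        moreover have "strict_prefix (key n l) v"
          using comb y(2) by (intro strict_prefixI'[where z = L and zs = c]) (simp add: key_def)
        ultimately have "strict_prefix (key n (Suc K)) v"
          by (rule prefix_order.le_less_trans)
        then show False using deep v(1) * by blast
      qed
      then have "l \<in> I" using comb(1) K(1) by (auto simp: I_def)
      moreover have "v \<in> A l" using comb y(2) by (simp add: A_def key_def)
      ultimately show ?thesis by blast
    next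
      case (path l c)
      then have "last v = R" using y(2) by (auto simp: nodes_right_path)
      then show ?thesis using v(2) by simp
    qed
  qed
  then have "card {v \<in> V. last v = L} \<le> card (key n ` {..m} \<union> (\<Union>l\<in>I. A l))"
    by (rule card_mono[rotated]) (auto simp: fin A_def finite_nodes)
  also have "\<dots> \<le> card (key n ` {..m}) + card (\<Union>l\<in>I. A l)" by (rule card_Un_le)
  also have "\<dots> \<le> Suc m + (\<Sum>l\<in>I. 2 * comb_size n l)"
  proof (rule add_mono)
    show "card (key n ` {..m}) \<le> Suc m" using card_image_le[of "{..m}" "key n"] by simp
    show "card (\<Union>l\<in>I. A l) \<le> (\<Sum>l\<in>I. 2 * comb_size n l)"
    proof (rule card_UN_le_sum[OF fin])
      fix l show "card (A l) \<le> 2 * comb_size n l"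
        unfolding A_def using card_image_le[OF finite_nodes] card_nodes_comb le_trans by blast
    qed
  qed
  also have "(\<Sum>l\<in>I. 2 * comb_size n l) = 2 * (\<Sum>l\<in>I. comb_size n l)" by (simp add: sum_distrib_left)
  also have "(\<Sum>l\<in>I. comb_size n l) \<le> 3 * comb_size n K"
    using sum_levels_le[OF K(1), of "m + n div p"] K(1) by (simp add: I_def comb_size_def min_def)
  finally have "card {v \<in> V. last v = L} < 8 * comb_size n K" using m_less[of n K] by linarith
  then show ?thesis using K low by blast
qed

text \<open>The same argument runs along the odd vertices, where \<open>R\<close> is the branch of
  the path and \<open>L\<close> leads to the next level. The right edges of combs are estimated over
  all levels, as a path outweighs them together. The level found here is not claimed to be the one
  for left edges.\<close>

lemma right_edges_bounds:
  assumes k: "k < m" "key n k \<in> V" "key n (Suc k) \<in> V"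
  shows "\<exists>K<m. path_size n K \<le> card {v \<in> V. last v = R} \<and>
    card {v \<in> V. last v = R} < 8 * path_size n K"
proof -
  have "key n k @ [R] \<in> V"
    by (rule vertex_cluster_convex[OF V k(2,3)]) (auto simp: key_Suc)
  moreover have "(key n k @ [R]) @ [L] \<in> V" using k(3) by (simp add: key_Suc)
  moreover have "(key n l @ [R]) @ [L] \<in> nodes tree" if "l < m" for l
    using key_in_tree[OF n, of "Suc l"] that by (simp add: key_Suc)
  ultimately obtain K d' where K: "K < m"
    and full: "\<And>z. z \<in> nodes tree \<Longrightarrow> prefix ((key n K @ [R]) @ [d']) z \<Longrightarrow> z \<in> V"
    and deep: "\<And>z. Suc K < m \<Longrightarrow> z \<in> V \<Longrightarrow> \<not> strict_prefix (key n (Suc K) @ [R]) z"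
    using vertex_cluster_deepest[OF V, of "\<lambda>k. key n k @ [R]" m L k] prefix_key_R k(1)
    by (metis (no_types, lifting))
  define k' where "k' = (case d' of R \<Rightarrow> K | L \<Rightarrow> Suc K)"
  have k': "K \<le> k'" "k' \<le> m" using K by (auto simp: k'_def split: dir.splits)
  have low: "path_size n K \<le> card {v \<in> V. last v = R}"
  proof (rule le_card_if_inj)
    show "inj (\<lambda>i. key n k' @ R # R # replicate i R)"
      by (rule injI) (auto dest: arg_cong[where f = length])
    fix i assume "i < path_size n K"
    then have "key n k' @ R # R # replicate i R \<in> nodes tree"
      using path_in_tree[OF n] k' path_size_mono less_le_trans by metis
    moreover have "prefix ((key n K @ [R]) @ [d']) (key n k' @ R # R # replicate i R)"
      by (cases d') (auto simp: k'_def key_Suc)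
    ultimately show "key n k' @ R # R # replicate i R \<in> {v \<in> V. last v = R}"
      using full by simp
  qed (simp add: cluster_finite)
  define I where "I = {l. l \<le> m \<and> (l \<le> K \<or> Suc K = m)}"
  have fin: "finite I" by (simp add: I_def)
  define A where "A l = (\<lambda>c. key n l @ L # c) ` nodes (comb (comb_size n l))" for l
  define B where "B l = (\<lambda>c. key n l @ R # R # c) ` nodes (right_path (path_size n l))" for l
  define M where "M = (\<lambda>l. key n l @ [R]) ` {..m}"
  have "{v \<in> V. last v = R} \<subseteq> (M \<union> (\<Union>l\<in>{..m}. A l)) \<union> (\<Union>l\<in>I. B l)"
  proof
    fix v assume "v \<in> {v \<in> V. last v = R}"
    then have v: "v \<in> V" "last v = R" by auto
    obtain y where y: "y \<in> nodes (block n)" "v = root n @ y" using cluster_in_block[OF v(1)] by blast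
    from y(1) show "v \<in> (M \<union> (\<Union>l\<in>{..m}. A l)) \<union> (\<Union>l\<in>I. B l)"
    proof (cases rule: block_cases)
      case (key l)
      then have "last v = L" using y(2) by (cases l) (auto simp: root_def zig_Suc_snoc)
      then show ?thesis using v(2) by simp
    next
      case (mid l)
      then show ?thesis using y(2) by (auto simp: key_def M_def)
    next
      case (comb l c)
      then show ?thesis using y(2) by (auto simp: key_def A_def)
    next
      case (path l c)
      have "\<not> (Suc K < m \<and> Suc K \<le> l)"
      proof
        assume *: "Suc K < m \<and> Suc K \<le> l"
        then have "prefix (key n (Suc K) @ [R]) (key n l @ [R])"
          by (intro prefix_key_R) simp
        moreover have "strict_prefix (key n l @ [R]) v"
          using path y(2) by (intro strict_prefixI'[where z = R and zs = c]) (simp add: key_def)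
        ultimately have "strict_prefix (key n (Suc K) @ [R]) v"
          by (rule prefix_order.le_less_trans)
        then show False using deep v(1) * by blast
      qed
      then have "l \<in> I" using path(1) K(1) by (auto simp: I_def)
      moreover have "v \<in> B l" using path y(2) by (simp add: B_def key_def)
      ultimately show ?thesis by blast
    qed
  qed
  then have "card {v \<in> V. last v = R} \<le> card ((M \<union> (\<Union>l\<in>{..m}. A l)) \<union> (\<Union>l\<in>I. B l))"
    by (rule card_mono[rotated]) (auto simp: fin A_def B_def M_def finite_nodes)
  also have "\<dots> \<le> card (M \<union> (\<Union>l\<in>{..m}. A l)) + card (\<Union>l\<in>I. B l)" by (rule card_Un_le)
  also have "\<dots> \<le> (card M + card (\<Union>l\<in>{..m}. A l)) + card (\<Union>l\<in>I. B l)"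
    by (rule add_right_mono[OF card_Un_le])
  also have "\<dots> \<le> (Suc m + (\<Sum>l\<in>{..m}. 2 * comb_size n l)) + (\<Sum>l\<in>I. path_size n l)"
  proof (intro add_mono)
    show "card M \<le> Suc m"
      using card_image_le[of "{..m}" "\<lambda>l. key n l @ [R]"] by (simp add: M_def)
    show "card (\<Union>l\<in>{..m}. A l) \<le> (\<Sum>l\<in>{..m}. 2 * comb_size n l)"
    proof (rule card_UN_le_sum)
      fix l show "card (A l) \<le> 2 * comb_size n l"
        unfolding A_def using card_image_le[OF finite_nodes] card_nodes_comb le_trans by blast
    qed simp
    show "card (\<Union>l\<in>I. B l) \<le> (\<Sum>l\<in>I. path_size n l)"
    proof (rule card_UN_le_sum[OF fin])
      fix l show "card (B l) \<le> path_size n l"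
        unfolding B_def using card_image_le[OF finite_nodes] card_nodes_right_path le_trans by blast
    qed
  qed
  finally have up: "card {v \<in> V. last v = R} \<le>
    Suc m + 2 * (\<Sum>l\<le>m. comb_size n l) + (\<Sum>l\<in>I. path_size n l)" by (simp add: sum_distrib_left)
  have paths: "(\<Sum>l\<in>I. path_size n l) \<le> 3 * path_size n K"
    using sum_levels_le[OF K(1), of "m + p * m + n mod p"] K(1)
    by (simp add: I_def path_size_def min_def)
  \<comment> \<open>With \<open>m - 1\<close> as deepest level, \<open>sum_levels_le\<close> covers
    all levels.\<close>
  have "{l. l \<le> m \<and> (l \<le> m - 1 \<or> Suc (m - 1) = m)} = {..m}" using m_pos by auto
  then have combs: "(\<Sum>l\<le>m. comb_size n l) \<le> 3 * comb_size n (m - 1)"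
    using sum_levels_le[of "m - 1" "m + n div p"] m_pos by (simp add: comb_size_def)
  have "n div p < p" using n by (simp add: less_mult_imp_div_less)
  then have "Suc (n div p + p * (m - 1)) \<le> p + p * (m - 1)" by simp
  also have "\<dots> = p * m" using m_pos by (cases m) auto
  finally have "8 * comb_size n (m - 1) \<le> 8 ^ (m + p * m)"
    unfolding comb_size_def power_Suc[symmetric] by (intro power_increasing) auto
  also have "\<dots> \<le> path_size n K" unfolding path_size_def by (intro power_increasing) auto
  finally have "card {v \<in> V. last v = R} < 8 * path_size n K"
    using up paths combs m_less[of n "m - 1"] by linarith
  then show ?thesis using K low by blast
qed

end

section \<open>Counting distinct clusters\<close>

text \<open>
  The upper part of the merge has its bottom boundary node inside the block, so if it leaves the
  block, it contains everything to the right.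
\<close>

lemma outside_contains_end:
  assumes n: "n < p * p" and k: "k < m"
    and x: "vertex_merge tree x" "separates x (key n k) (key n (Suc k))"
    and c: "c \<in> joined x" "\<not> prefix (root n) c"
  shows "replicate (p * p) R \<in> joined x"
proof -
  let ?e = "key n k" and ?f = "key n (Suc k)" and ?w = "replicate n R"
  obtain V V' r b r' b' where V: "joined x = V \<union> V'" "V \<inter> V' = {}" "?e \<in> V" "?f \<in> V'"
    "vertex_cluster tree V r b" "vertex_cluster tree V' r' b'"
    by (rule separates_cases[OF x]) (rule that)
  have ef: "prefix ?e ?f" by (simp add: prefix_key)
  have "?e \<notin> V'" "?f \<notin> V" using V by blast+
  have "prefix ?e v" if "v \<in> V'" for v
    using vertex_cluster_root_below[OF V(6) \<open>?e \<notin> V'\<close> V(4) ef that] .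
  then have "c \<notin> V'" using c(2) prefix_root_key prefix_order.trans by blast
  then have cV: "c \<in> V" using c V by blast
  have "strict_prefix r ?e" "strict_prefix r c"
    using vertex_cluster_root[OF V(5)] V(3) cV by blast+
  then have r: "prefix r ?e" "prefix r c" by auto
  \<comment> \<open>The cluster root is above a vertex inside and a vertex outside the block, so it
    is at or above the spine vertex \<open>?w\<close> to which the block is attached.\<close>
  have "\<not> prefix (root n) r" using r(2) c(2) prefix_order.trans by blast
  then have rw: "prefix r ?w"
    using prefix_same_cases[OF r(1) prefix_root_key] unfolding root_def by (auto simp: prefix_snoc)
  \<comment> \<open>If \<open>r\<close> is strictly above \<open>?w\<close>, the right child of
    \<open>?w\<close> enters as a sibling of the block root. If \<open>r\<close> equals
    \<open>?w\<close>, it is on the path to \<open>c\<close>.\<close>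
  have right: "?w @ [R] \<in> V"
  proof (cases "r = ?w")
    case False
    then have "strict_prefix r ?w" using rw by auto
    moreover have w: "prefix ?w ?e" by (simp add: key_def root_def)
    ultimately have "?w \<in> V" using vertex_cluster_path[OF V(5,3)] by blast
    moreover have "?w @ [L] \<in> V"
      using vertex_cluster_convex[OF V(5) \<open>?w \<in> V\<close> V(3)] by (simp add: key_def root_def)
    moreover have "?w @ [R] \<in> nodes tree"
      using spine_in_tree[of "Suc n"] n by (simp add: replicate_append_same)
    ultimately show ?thesis using vertex_cluster_sibling[OF V(5)] by blast
  next
    case True
    then obtain d q where d: "c = ?w @ d # q"
      using \<open>strict_prefix r c\<close> by (auto elim: strict_prefixE')
    have "d = R" using c(2) d by (cases d) (auto simp: root_def)
    then have "prefix (?w @ [R]) c" using d by simp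
    moreover have "strict_prefix r (?w @ [R])" using True by (auto intro: strict_prefixI')
    ultimately show ?thesis using vertex_cluster_path[OF V(5) cV] by blast
  qed
  have fT: "?f \<in> nodes tree" using key_in_tree n k by simp
  \<comment> \<open>The bottom boundary node is below \<open>?e\<close>, hence inside the block, so
    nothing is cut off along the spine to the right.\<close>
  have "prefix ?e b"
    using vertex_cluster_bottom_below[OF V(5) V(3) \<open>?f \<notin> V\<close> fT ef] .
  moreover have "\<not> (prefix (?w @ [R]) b \<and> prefix (?w @ [L]) b)"
    by (auto simp: prefix_def)
  moreover have "prefix (?w @ [L]) ?e" by (simp add: key_def root_def)
  ultimately have "\<not> prefix (?w @ [R]) b" using prefix_order.trans by blast
  moreover have "replicate (p * p) R = (?w @ [R]) @ replicate (p * p - Suc n) R"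
    using n by (simp add: replicate_append_same replicate_add[symmetric] flip: replicate_Suc)
  then have "prefix (?w @ [R]) (replicate (p * p) R)" by (metis prefixI)
  ultimately have "replicate (p * p) R \<in> V"
    using vertex_cluster_below[OF V(5) right] spine_in_tree by blast
  then show ?thesis using V(1) by blast
qed

text \<open>The number of left edges determines \<open>n div p\<close> and the deepest level
  \<open>K\<close>, the number of right edges determines \<open>n mod p\<close>. So the blocks agree
  and both clusters contain \<open>key n K\<close>.\<close>

lemma inside_meet:
  assumes x: "vertex_merge tree x" "\<And>v. v \<in> joined x \<Longrightarrow> prefix (root n) v" "n < p * p"
      "k < m" "key n k \<in> joined x" "key n (Suc k) \<in> joined x"
    and y: "vertex_merge tree y" "\<And>v. v \<in> joined y \<Longrightarrow> prefix (root n') v" "n' < p * p"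
      "k' < m" "key n' k' \<in> joined y" "key n' (Suc k') \<in> joined y"
    and t: "snd (snd x) = snd (snd y)"
  shows "n = n' \<and> joined x \<inter> joined y \<noteq> {}"
proof -
  have vc: "\<exists>r b. vertex_cluster tree (joined x) r b" if "vertex_merge tree x" for x
    using that by (cases x) (simp add: vertex_merge_def joined_def)
  have same: "card {v \<in> joined x. last v = d} = card {v \<in> joined y. last v = d}" for d
    unfolding vertex_merge_card[OF x(1)] vertex_merge_card[OF y(1)] t ..
  obtain r b where vx: "vertex_cluster tree (joined x) r b" using vc[OF x(1)] by blast
  obtain r' b' where vy: "vertex_cluster tree (joined y) r' b'" using vc[OF y(1)] by blast
  obtain K where K: "K < m" "key n K \<in> joined x" "comb_size n K \<le> card {v \<in> joined x. last v = L}"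
      "card {v \<in> joined x. last v = L} < 8 * comb_size n K"
    using left_edges_bounds[OF vx x(2) x(3-6)] by blast
  obtain K' where K': "K' < m" "key n' K' \<in> joined y" "comb_size n' K' \<le> card {v \<in> joined y. last v = L}"
      "card {v \<in> joined y. last v = L} < 8 * comb_size n' K'"
    using left_edges_bounds[OF vy y(2) y(3-6)] by blast
  obtain J where J: "J < m" "path_size n J \<le> card {v \<in> joined x. last v = R}"
      "card {v \<in> joined x. last v = R} < 8 * path_size n J"
    using right_edges_bounds[OF vx x(2) x(3-6)] by blast
  obtain J' where J': "J' < m" "path_size n' J' \<le> card {v \<in> joined y. last v = R}"
      "card {v \<in> joined y. last v = R} < 8 * path_size n' J'"
    using right_edges_bounds[OF vy y(2) y(3-6)] by blast
  have "min K (m - 1) = K" "min K' (m - 1) = K'" "min J (m - 1) = J" "min J' (m - 1) = J'"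
    using K(1) K'(1) J(1) J'(1) by auto
  note sizes = comb_size_def path_size_def this power_Suc[symmetric]
  have "m + n div p + p * K = m + n' div p + p * K'"
    by (rule power_interval_unique[OF K(3,4)[unfolded sizes] K'(3,4)[folded same, unfolded sizes]])
  then have left: "K = K' \<and> n div p = n' div p"
    using x(3) y(3) by (intro digits_unique[of p]) (auto simp: less_mult_imp_div_less)
  have "m + p * m + n mod p + p * J = m + p * m + n' mod p + p * J'"
    by (rule power_interval_unique[OF J(2,3)[unfolded sizes] J'(2,3)[folded same, unfolded sizes]])
  then have "J = J' \<and> n mod p = n' mod p"
    using p_pos by (intro digits_unique[of p]) auto
  then have "n = n'" using left by (metis div_mult_mod_eq)
  then show ?thesis using left K(2) K'(2) by blast
qed

lemma dag_size_tree:
  assumes t: "top_tree tree t"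
  shows "p * p * m \<le> 2 * dag_size t"
proof -
  have key_edge: "key n k \<in> snd ` edges tree" if "n < p * p" "k \<le> m" for n k
    using key_in_tree[OF that] by (intro nodes_in_snd_edges) (auto simp: key_def root_def)
  then have "edges tree \<noteq> {}" using p_pos by fastforce
  then have "top_tree_of tree (edges tree) t" using t by (simp add: top_tree_def)
  then obtain F where F: "merge_family tree (edges tree) t F" using merge_family_exists by blast
  define A where "A = {..<p * p} \<times> {..<m}"
  have "\<exists>x\<in>F. separates x (key n k) (key n (Suc k))" if "n < p * p" "k < m" for n k
    using that by (intro merge_family_separates[OF F key_edge key_edge]) (auto simp: key_Suc)
  then have "\<forall>a\<in>A. \<exists>x\<in>F. separates x (key (fst a) (snd a)) (key (fst a) (Suc (snd a)))"
    by (auto simp: A_def)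
  then obtain X where X: "\<And>a. a \<in> A \<Longrightarrow> X a \<in> F"
      "\<And>a. a \<in> A \<Longrightarrow> separates (X a) (key (fst a) (snd a)) (key (fst a) (Suc (snd a)))"
    by metis
  have merge: "vertex_merge tree (X a)" if "a \<in> A" for a
    using merge_familyD(1)[OF F X(1)[OF that]] .
  have in_joined: "key (fst a) (snd a) \<in> joined (X a)" "key (fst a) (Suc (snd a)) \<in> joined (X a)"
    if "a \<in> A" for a
    using X(2)[OF that] by (auto simp: separates_def joined_def split: prod.splits)
  \<comment> \<open>The block is recovered by \<open>separates_lower_part\<close>, the level by
    \<open>separates_unique\<close>.\<close>
  have inj_X: "a = a'" if a: "a \<in> A" "a' \<in> A" "X a = X a'" for a a'
  proof -
    obtain n k n' k' where nk: "a = (n, k)" "a' = (n', k')" by (cases a, cases a') auto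
    have s: "separates (X a) (key n k) (key n (Suc k))" "separates (X a) (key n' k') (key n' (Suc k'))"
      using X(2)[OF a(1)] X(2)[OF a(2)] nk a(3) by auto
    have "prefix (root n) (key n' k') \<or> prefix (root n) (key n' (Suc k'))"
      using separates_lower_part[OF merge[OF a(1)] s] prefix_root_key prefix_order.trans
      by (meson prefix_key Suc_leD le_refl)
    then have n: "n = n'"
      unfolding key_def root_def by (auto simp: prefix_def replicate_branch_eq_iff)
    have False if "k < k'"
      using separates_unique[OF merge[OF a(1)] s] n that by (simp add: prefix_key)
    moreover have False if "k' < k"
      using separates_unique[OF merge[OF a(1)] s(2,1)] n that by (simp add: prefix_key)
    ultimately show ?thesis using nk n by (metis linorder_neqE_nat)
  qed
  \<comment> \<open>\<open>G\<close> collects the pairs whose merge stays inside its block. Both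
    \<open>G\<close> and its complement inject into the nodes of the DAG, whence the factor
    2.\<close>
  define G where "G = {a \<in> A. \<forall>v\<in>joined (X a). prefix (root (fst a)) v}"
  let ?D = "subtrees t - {\<langle>\<rangle>}"
  have finD: "finite ?D" by (induction t) auto
  have DX: "snd (snd (X a)) \<in> ?D" if "a \<in> A" for a
    using merge_familyD(3,4)[OF F X(1)[OF that]] by blast
  have "inj_on (\<lambda>a. snd (snd (X a))) G"
  proof (rule inj_onI)
    fix a a' assume a: "a \<in> G" "a' \<in> G" and same: "snd (snd (X a)) = snd (snd (X a'))"
    then have A: "a \<in> A" "a' \<in> A" by (auto simp: G_def)
    have "joined (X a) \<inter> joined (X a') \<noteq> {}"
      using inside_meet[OF merge[OF A(1)] _ _ _ in_joined[OF A(1)]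
          merge[OF A(2)] _ _ _ in_joined[OF A(2)] same] a A
      by (auto simp: G_def A_def)
    then show "a = a'"
      using merge_family_determined[OF F X(1)[OF A(1)] X(1)[OF A(2)] same] inj_X A by blast
  qed
  then have G: "card G \<le> card ?D"
    by (rule card_inj_on_le) (use DX finD in \<open>auto simp: G_def\<close>)
  have "inj_on (\<lambda>a. snd (snd (X a))) (A - G)"
  proof (rule inj_onI)
    fix a a' assume a: "a \<in> A - G" "a' \<in> A - G" and same: "snd (snd (X a)) = snd (snd (X a'))"
    then have A: "a \<in> A" "a' \<in> A" by auto
    have "replicate (p * p) R \<in> joined (X a)" if "a \<in> A - G" for a
      using that outside_contains_end[of "fst a" "snd a" "X a"] merge[of a] X(2)[of a]
      by (auto simp: G_def A_def)
    then have "joined (X a) \<inter> joined (X a') \<noteq> {}" using a by blast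
    then show "a = a'"
      using merge_family_determined[OF F X(1)[OF A(1)] X(1)[OF A(2)] same] inj_X A by blast
  qed
  then have "card (A - G) \<le> card ?D"
    by (rule card_inj_on_le) (use DX finD in auto)
  moreover have "card A = card G + card (A - G)"
  proof -
    have "G \<subseteq> A" "finite A" by (auto simp: G_def A_def)
    then show ?thesis by (metis card_Diff_subset card_mono finite_subset le_add_diff_inverse)
  qed
  moreover have "card A = p * p * m" by (simp add: A_def)
  ultimately show ?thesis using G by (simp add: dag_size_def)
qed

section \<open>The word and its program\<close>

text \<open>The levels up to \<open>m\<close> use separators up to \<open>2 * m + 2\<close>. Combs
  also use \<open>Suc top_letter\<close>, so all letters are below \<open>2 * m + 5\<close>.\<close>

definition top_letter :: nat where
  "top_letter = 2 * m + 3"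

text \<open>A comb depends on the block only through the quotient by \<open>p\<close>;
  \<open>i * p\<close> is a block with quotient \<open>i\<close>.\<close>

definition comb_piece :: "nat \<Rightarrow> nat \<Rightarrow> nat list" where
  "comb_piece i l = comb_word top_letter (comb_size (i * p) l) @ [2 * l + 1]"

definition path_piece :: "nat \<Rightarrow> nat \<Rightarrow> nat list" where
  "path_piece j l = (2 * l + 2) # replicate (path_size j l) top_letter"

definition left_half :: "nat \<Rightarrow> nat \<Rightarrow> nat list" where
  "left_half i k = concat (map (comb_piece i) [k..<Suc m])"

definition right_half :: "nat \<Rightarrow> nat \<Rightarrow> nat list" where
  "right_half j k = concat (map (path_piece j) (rev [k..<Suc m]))"

definition block_word :: "nat \<Rightarrow> nat list" where
  "block_word n = left_half (n div p) 0 @ right_half (n mod p) 0"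

definition tree_word :: "nat list" where
  "tree_word = spine_word (map block_word [0..<p * p])"

lemma block_word_eq:
  "block_word n = zigzag_word top_letter (comb_size n) (path_size n) 0 (Suc m)"
proof -
  have "comb_size (n div p * p) = comb_size n" "path_size (n mod p) = path_size n"
    by (rule ext, simp add: comb_size_def path_size_def p_pos)+
  then show ?thesis
    unfolding block_word_def left_half_def right_half_def zigzag_word_split add_0
      comb_piece_def[abs_def] path_piece_def[abs_def] by simp
qed

lemma cartesian_tree_word: "cartesian_tree tree_word = tree"
proof -
  have "0 \<notin> set (block_word n)" for n
    using set_zigzag_word[of 0 "Suc m" top_letter] unfolding block_word_eq
    by (force simp: top_letter_def)
  then have "cartesian_tree tree_word = right_spine (map cartesian_tree (map block_word [0..<p * p]))"
    unfolding tree_word_def by (intro cartesian_tree_spine_word) auto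
  also have "cartesian_tree (block_word n) = block n" for n
    unfolding block_word_eq block_def by (rule cartesian_tree_zigzag_word) (simp add: top_letter_def)
  then have "map cartesian_tree (map block_word [0..<p * p]) = map block [0..<p * p]" by simp
  finally show ?thesis by (simp add: tree_def)
qed

lemma set_spine_word: "set (spine_word ws) = {0} \<union> (\<Union>w\<in>set ws. set w)"
  by (induction ws) auto

lemma set_tree_word: "set tree_word \<subseteq> {0..<2 * m + 5}"
proof -
  have "set (block_word n) \<subseteq> {0..<2 * m + 5}" for n
    using set_zigzag_word[of 0 "Suc m" top_letter] unfolding block_word_eq
    by (force simp: top_letter_def)
  then show ?thesis unfolding tree_word_def set_spine_word by auto
qed

text \<open>All sizes are powers of 8. Read as powers of 2 they are reached by doubling, and this
  bounds the exponents that occur.\<close>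

definition max_exponent :: nat where
  "max_exponent = 3 * (m + 2 * (p * m))"

lemma eight_power: "(8::nat) ^ e = 2 ^ (3 * e)"
  by (simp add: power_mult)

lemma level_bound: "p * min k (m - 1) + p \<le> p * m"
proof -
  have "p * min k (m - 1) + p = p * Suc (min k (m - 1))" by simp
  also have "\<dots> \<le> p * m" using m_pos by (intro mult_left_mono) auto
  finally show ?thesis .
qed

lemma comb_size_power:
  assumes "i < p"
  shows "\<exists>e\<le>max_exponent. comb_size (i * p) k = 2 ^ e"
proof (intro exI conjI)
  show "comb_size (i * p) k = 2 ^ (3 * (m + i + p * min k (m - 1)))"
    unfolding comb_size_def eight_power using p_pos by simp
  define q r where "q = p * min k (m - 1)" and "r = p * m"
  have "q + p \<le> r" unfolding q_def r_def by (rule level_bound)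
  then show "3 * (m + i + p * min k (m - 1)) \<le> max_exponent"
    using assms unfolding max_exponent_def q_def[symmetric] r_def[symmetric] by (intro mult_le_mono2) linarith
qed

lemma path_size_power:
  assumes "j < p"
  shows "\<exists>e\<le>max_exponent. path_size j k = 2 ^ e"
proof (intro exI conjI)
  show "path_size j k = 2 ^ (3 * (m + p * m + j + p * min k (m - 1)))"
    unfolding path_size_def eight_power using assms by simp
  define q r where "q = p * min k (m - 1)" and "r = p * m"
  have "q + p \<le> r" unfolding q_def r_def by (rule level_bound)
  then show "3 * (m + p * m + j + p * min k (m - 1)) \<le> max_exponent"
    using assms unfolding max_exponent_def q_def[symmetric] r_def[symmetric] by (intro mult_le_mono2) linarith
qed

lemma left_half_step:
  "k < m \<Longrightarrow> left_half i k = comb_piece i k @ left_half i (Suc k)"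
  by (simp add: left_half_def upt_conv_Cons del: upt_Suc)

lemma left_half_last: "left_half i m = comb_piece i m"
  by (simp add: left_half_def)

lemma right_half_step:
  "k < m \<Longrightarrow> right_half j k = right_half j (Suc k) @ path_piece j k"
  by (simp add: right_half_def upt_conv_Cons del: upt_Suc)

lemma right_half_last: "right_half j m = path_piece j m"
  by (simp add: right_half_def)

lemma half_nonempty: "k \<le> m \<Longrightarrow> left_half i k \<noteq> []" "k \<le> m \<Longrightarrow> right_half j k \<noteq> []"
  by (cases "k = m"; simp add: left_half_step left_half_last right_half_step right_half_last
      comb_piece_def path_piece_def)+

lemma spine_word_nonempty: "spine_word ws \<noteq> []"
  by (cases ws) auto

definition suffix_word :: "nat \<Rightarrow> nat list" where
  "suffix_word n = spine_word (map block_word [n..<p * p])"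

text \<open>Halves are built one level at a time and shared by all blocks with the same quotient or
  remainder. The words \<open>block_word n @ [0]\<close> are there because a rule joins only two
  words, whereas a step along the spine joins three.\<close>

definition factors :: "nat list set" where
  "factors = (\<lambda>a. [a]) ` {..<2 * m + 5}
     \<union> (\<lambda>e. replicate (2 ^ e) top_letter) ` {..max_exponent}
     \<union> (\<lambda>e. comb_word top_letter (2 ^ e)) ` {..max_exponent}
     \<union> case_prod comb_piece ` ({..<p} \<times> {..m}) \<union> case_prod path_piece ` ({..<p} \<times> {..m})
     \<union> case_prod left_half ` ({..<p} \<times> {..m}) \<union> case_prod right_half ` ({..<p} \<times> {..m})
     \<union> block_word ` {..<p * p} \<union> (\<lambda>n. block_word n @ [0]) ` {..<p * p}
     \<union> suffix_word ` {..p * p}"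

lemma factorsI:
  "a < 2 * m + 5 \<Longrightarrow> [a] \<in> factors"
  "e \<le> max_exponent \<Longrightarrow> replicate (2 ^ e) top_letter \<in> factors"
  "e \<le> max_exponent \<Longrightarrow> comb_word top_letter (2 ^ e) \<in> factors"
  "i < p \<Longrightarrow> k \<le> m \<Longrightarrow> comb_piece i k \<in> factors"
  "i < p \<Longrightarrow> k \<le> m \<Longrightarrow> path_piece i k \<in> factors"
  "i < p \<Longrightarrow> k \<le> m \<Longrightarrow> left_half i k \<in> factors"
  "i < p \<Longrightarrow> k \<le> m \<Longrightarrow> right_half i k \<in> factors"
  "n < p * p \<Longrightarrow> block_word n \<in> factors"
  "n < p * p \<Longrightarrow> block_word n @ [0] \<in> factors"
  "n \<le> p * p \<Longrightarrow> suffix_word n \<in> factors"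
  unfolding factors_def by force+

lemma factors_cases:
  assumes "w \<in> factors"
  obtains (letter) a where "w = [a]"
  | (power) e where "e \<le> max_exponent" "w = replicate (2 ^ e) top_letter"
  | (comb) e where "e \<le> max_exponent" "w = comb_word top_letter (2 ^ e)"
  | (comb_piece) i k where "i < p" "k \<le> m" "w = comb_piece i k"
  | (path_piece) i k where "i < p" "k \<le> m" "w = path_piece i k"
  | (left) i k where "i < p" "k \<le> m" "w = left_half i k"
  | (right) i k where "i < p" "k \<le> m" "w = right_half i k"
  | (block) n where "n < p * p" "w = block_word n"
  | (sep) n where "n < p * p" "w = block_word n @ [0]"
  | (suffix) n where "n \<le> p * p" "w = suffix_word n"
  using assms unfolding factors_def by (elim UnE imageE) auto

lemma factors_closed:
  assumes "w \<in> factors"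
  shows "(\<exists>a. w = [a]) \<or> (\<exists>u\<in>factors. \<exists>v\<in>factors. u \<noteq> [] \<and> v \<noteq> [] \<and> w = u @ v)"
    (is "?P w")
proof -
  have split: "?P w" if "u \<in> factors" "v \<in> factors" "u \<noteq> []" "v \<noteq> []" "w = u @ v" for u v w
    using that by blast
  have comb_split: "?P (comb_piece i k)" if "i < p" "k \<le> m" for i k
  proof -
    obtain e where e: "e \<le> max_exponent" "comb_size (i * p) k = 2 ^ e"
      using comb_size_power \<open>i < p\<close> by blast
    show ?thesis
      by (rule split[OF factorsI(3)[OF e(1)] factorsI(1)[of "2 * k + 1"]])
        (use that e in \<open>auto simp: comb_piece_def comb_word_eq_Nil\<close>)
  qed
  have path_split: "?P (path_piece j k)" if "j < p" "k \<le> m" for j k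
  proof -
    obtain e where e: "e \<le> max_exponent" "path_size j k = 2 ^ e"
      using path_size_power \<open>j < p\<close> by blast
    show ?thesis
      by (rule split[OF factorsI(1)[of "2 * k + 2"] factorsI(2)[OF e(1)]])
        (use that e in \<open>auto simp: path_piece_def\<close>)
  qed
  from assms show ?thesis
  proof (cases rule: factors_cases)
    case (letter a)
    then show ?thesis by blast
  next
    case (power e)
    show ?thesis
    proof (cases e)
      case 0
      then show ?thesis using power by simp
    next
      case (Suc e')
      have "replicate (2 ^ e') top_letter \<in> factors" using factorsI(2) power(1) Suc by simp
      from split[OF this this] show ?thesis
        using power(2) Suc by (simp add: replicate_add[symmetric] mult_2)
    qed
  next
    case (comb e)
    show ?thesis
    proof (cases e)
      case 0
      have "comb_word top_letter 1 = [Suc top_letter] @ [top_letter]" by (simp add: comb_word_def)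
      then show ?thesis
        using split[OF factorsI(1)[of "Suc top_letter"] factorsI(1)[of top_letter]] comb 0
        by (simp add: top_letter_def)
    next
      case (Suc e')
      have "comb_word top_letter (2 ^ e') \<in> factors" using factorsI(3) comb(1) Suc by simp
      from split[OF this this] show ?thesis
        using comb(2) Suc by (simp add: comb_word_add[symmetric] mult_2 comb_word_eq_Nil)
    qed
  next
    case (comb_piece i k)
    then show ?thesis using comb_split by blast
  next
    case (path_piece i k)
    then show ?thesis using path_split by blast
  next
    case (left i k)
    show ?thesis
    proof (cases "k = m")
      case True
      then show ?thesis using left comb_split left_half_last by metis
    next
      case False
      then have "k < m" using left by simp
      then show ?thesis
        using split[OF factorsI(4)[OF left(1,2)] factorsI(6)[OF left(1), of "Suc k"]]
          half_nonempty(1)[of "Suc k"] left(3) left_half_step by (simp add: comb_piece_def)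
    qed
  next
    case (right j k)
    show ?thesis
    proof (cases "k = m")
      case True
      then show ?thesis using right path_split right_half_last by metis
    next
      case False
      then have "k < m" using right by simp
      then show ?thesis
        using split[OF factorsI(7)[OF right(1), of "Suc k"] factorsI(5)[OF right(1,2)]]
          half_nonempty(2)[of "Suc k"] right(3) right_half_step by (simp add: path_piece_def)
    qed
  next
    case (block n)
    have "n div p < p" "n mod p < p" using block(1) p_pos by (simp_all add: less_mult_imp_div_less)
    then show ?thesis
      using split[OF factorsI(6)[of _ 0] factorsI(7)[of _ 0]] half_nonempty[of 0] block(2)
      by (simp add: block_word_def)
  next
    case (sep n)
    then show ?thesis
      using split[OF factorsI(8)[OF sep(1)] factorsI(1)[of 0]] half_nonempty[of 0]
      by (simp add: block_word_def)
  next
    case (suffix n)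
    show ?thesis
    proof (cases "n = p * p")
      case True
      then show ?thesis using suffix by (simp add: suffix_word_def)
    next
      case False
      then have n: "n < p * p" using suffix by simp
      then have "suffix_word n = (block_word n @ [0]) @ suffix_word (Suc n)"
        by (simp add: suffix_word_def upt_conv_Cons)
      then show ?thesis
        using split[OF factorsI(9)[OF n] factorsI(10)[of "Suc n"]] n suffix(2)
        by (simp add: suffix_word_def spine_word_nonempty)
    qed
  qed
qed

lemma finite_factors: "finite factors"
  by (simp add: factors_def)

text \<open>Only the blocks, their extensions by \<open>0\<close> and the suffixes number about
  \<open>p * p\<close>. The remaining classes have O(\<open>p * m\<close>) members, and
  \<open>m_le_p\<close> gives \<open>p * m \<le> p * p\<close>.\<close>

lemma card_factors: "card factors \<le> 40 * (p * p)"
proof -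
  have un: "card (A \<union> B) \<le> a + b" if "card A \<le> a" "card B \<le> b" for A B :: "nat list set" and a b
    using card_Un_le[of A B] that by linarith
  have im: "card (h ` A) \<le> card A" if "finite A" for h :: "'b \<Rightarrow> nat list" and A
    by (rule card_image_le[OF that])
  have "card factors \<le> (2 * m + 5) + Suc max_exponent + Suc max_exponent + p * Suc m + p * Suc m
      + p * Suc m + p * Suc m + p * p + p * p + Suc (p * p)"
    unfolding factors_def by (intro un; rule order.trans[OF card_image_le]) simp_all
  also have "\<dots> \<le> 40 * (p * p)"
  proof -
    define q r where "q = p * p" and "r = p * m"
    have "m * 1 \<le> q" "p * 1 \<le> q" "1 * 1 \<le> q" unfolding q_def
      by (intro mult_le_mono; use m_le_p p_pos in simp)+
    moreover have "r \<le> q" unfolding q_def r_def using m_le_p by (rule mult_le_mono2)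
    ultimately show ?thesis
      unfolding max_exponent_def mult_Suc_right q_def[symmetric] r_def[symmetric] by simp
  qed
  finally show ?thesis .
qed

lemma slp_for_tree_word:
  assumes "40 * (p * p) \<le> s"
  shows "\<exists>(P :: (nat, nat) rules) A. slp_for P A tree_word \<and> card P = s"
proof (rule slp_of_closed_words[OF finite_factors _ _ factors_closed])
  show "card factors \<le> s" using card_factors assms by simp
  show "tree_word \<in> factors" using factorsI(10)[of 0] by (simp add: tree_word_def suffix_word_def)
qed

lemma hard_word_exists:
  assumes "40 * (p * p) \<le> s"
  shows "\<exists>S. set S \<subseteq> {0..<2 * m + 5} \<and>
    (\<exists>(P :: (nat, nat) rules) A. slp_for P A S \<and> card P = s) \<and>
    (\<forall>t. top_tree (cartesian_tree S) t \<longrightarrow> p * p * m \<le> 2 * dag_size t)"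
  using set_tree_word slp_for_tree_word[OF assms] dag_size_tree
  by (intro exI[of _ tree_word] conjI) (simp_all add: cartesian_tree_word)

end

section \<open>Choice of the parameters\<close>

lemma square_floor_exists:
  fixes c s :: nat
  assumes "0 < c"
  shows "\<exists>p. c * (p * p) \<le> s \<and> s < c * (Suc p * Suc p)"
proof -
  let ?P = "\<lambda>q. s < c * (q * q)"
  have "?P (Suc s)"
  proof -
    have "s < 1 * (Suc s * 1)" by simp
    also have "\<dots> \<le> c * (Suc s * Suc s)" using assms by (intro mult_le_mono) auto
    finally show ?thesis .
  qed
  moreover have "\<not> ?P 0" by simp
  ultimately obtain p where "\<not> ?P p" "?P (Suc p)" using ex_least_nat_less[of ?P "Suc s"] by blast
  then show ?thesis by (intro exI[of _ p]) auto
qed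

theorem theorem4:
  fixes c\<^sub>0 :: real
  assumes "c\<^sub>0 > 0"
  shows "\<exists>c>0. \<exists>\<sigma>\<^sub>0::nat. \<forall>\<sigma>\<ge>\<sigma>\<^sub>0. \<forall>s::nat. real s \<ge> c\<^sub>0 * real \<sigma> ^ 2 \<longrightarrow>
    (\<exists>S :: nat list. set S \<subseteq> {0..<\<sigma>} \<and>
      (\<exists>(P :: (nat, nat) rules) A. slp_for P A S \<and> card P = s) \<and>
      (\<forall>t. top_tree (cartesian_tree S) t \<longrightarrow>
        real (dag_size t) \<ge> c * real s * real \<sigma>))"
proof -
  \<comment> \<open>The bound \<open>1 / 4\<close> leaves room for the alphabet,
    \<open>2 * m + 5 \<le> \<sigma>\<close>; the square root gives
    \<open>40 * (m * m) \<le> s\<close>, hence \<open>m \<le> p\<close>.\<close>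
  define \<delta> where "\<delta> = min (1 / 4) (sqrt (c\<^sub>0 / 40))"
  have \<delta>: "0 < \<delta>" "\<delta> \<le> 1 / 4" using assms by (auto simp: \<delta>_def)
  have "\<delta>\<^sup>2 \<le> (sqrt (c\<^sub>0 / 40))\<^sup>2" using \<delta>(1) by (intro power_mono) (auto simp: \<delta>_def)
  then have \<delta>_sq: "40 * \<delta>\<^sup>2 \<le> c\<^sub>0" using assms by simp
  \<comment> \<open>The 10 absorbs the additive 5 in the alphabet. The other bound gives
    \<open>\<delta> * \<sigma> \<ge> 2\<close>, so rounding down to \<open>m\<close> loses at most
    half.\<close>
  define \<sigma>\<^sub>0 where "\<sigma>\<^sub>0 = max 10 (nat \<lceil>2 / \<delta>\<rceil>)"
  have main: "\<exists>S :: nat list. set S \<subseteq> {0..<\<sigma>} \<and>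
      (\<exists>(P :: (nat, nat) rules) A. slp_for P A S \<and> card P = s) \<and>
      (\<forall>t. top_tree (cartesian_tree S) t \<longrightarrow>
        real (dag_size t) \<ge> \<delta> / 640 * real s * real \<sigma>)"
    if \<sigma>: "\<sigma> \<ge> \<sigma>\<^sub>0" and s: "real s \<ge> c\<^sub>0 * real \<sigma> ^ 2" for \<sigma> s
  proof -
    define m where "m = nat \<lfloor>\<delta> * \<sigma>\<rfloor>"
    have \<sigma>10: "10 \<le> \<sigma>" and "nat \<lceil>2 / \<delta>\<rceil> \<le> \<sigma>" using \<sigma> by (auto simp: \<sigma>\<^sub>0_def)
    then have "2 / \<delta> \<le> \<sigma>" by linarith
    then have \<delta>\<sigma>: "2 \<le> \<delta> * \<sigma>" using \<delta>(1) by (simp add: field_simps)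
    have m_le: "real m \<le> \<delta> * \<sigma>" and m_ge: "\<delta> * \<sigma> - 1 \<le> real m"
      unfolding m_def using \<delta>\<sigma> by linarith+
    have m_half: "\<delta> * \<sigma> / 2 \<le> real m" using m_ge \<delta>\<sigma> by linarith
    have "\<delta> * \<sigma> \<le> 1 / 4 * \<sigma>" using \<delta>(2) by (intro mult_right_mono) auto
    then have letters: "2 * m + 5 \<le> \<sigma>" using m_le \<sigma>10 by linarith
    obtain p where p: "40 * (p * p) \<le> s" "s < 40 * (Suc p * Suc p)"
      using square_floor_exists[of 40 s] by auto
    have "real (40 * (m * m)) \<le> 40 * (\<delta> * \<sigma>)\<^sup>2"
      using power_mono[OF m_le, of 2] by (simp add: power2_eq_square)
    also have "\<dots> = (40 * \<delta>\<^sup>2) * real \<sigma> ^ 2" by (simp add: power_mult_distrib)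
    also have "\<dots> \<le> c\<^sub>0 * real \<sigma> ^ 2" using \<delta>_sq by (intro mult_right_mono) auto
    also have "\<dots> \<le> s" by (rule s)
    finally have "40 * (m * m) \<le> s" by (simp only: of_nat_le_iff)
    then have "m * m < Suc p * Suc p" using p(2) by linarith
    then have "m < Suc p" by (metis mult_le_mono not_less)
    moreover have "0 < m" using m_half \<delta>\<sigma> by linarith
    ultimately obtain S where S: "set S \<subseteq> {0..<2 * m + 5}"
        "\<exists>(P :: (nat, nat) rules) A. slp_for P A S \<and> card P = s"
        and dag: "\<And>t. top_tree (cartesian_tree S) t \<Longrightarrow> p * p * m \<le> 2 * dag_size t"
      using hard_word_exists[of m p s] p(1) by auto
    \<comment> \<open>As \<open>p\<close> is positive, \<open>Suc p\<close> is at most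
      \<open>2 * p\<close>, so \<open>s\<close> exceeds \<open>40 * (p * p)\<close> by a factor of
      at most 4. With the 2 from \<open>m_half\<close> and the 2 from \<open>dag\<close> this yields
      640.\<close>
    have "Suc p * Suc p \<le> (2 * p) * (2 * p)"
      using \<open>m < Suc p\<close> \<open>0 < m\<close> by (intro mult_le_mono) auto
    then have "s \<le> 160 * (p * p)" using p(2) by linarith
    then have sp: "real s \<le> 160 * real (p * p)"
      by (metis of_nat_le_iff of_nat_mult of_nat_numeral)
    have "\<delta> / 640 * real s * real \<sigma> \<le> real (dag_size t)"
      if t: "top_tree (cartesian_tree S) t" for t
    proof -
      have "real (p * p) * real m \<le> 2 * real (dag_size t)"
        using dag[OF t] by (metis of_nat_le_iff of_nat_mult of_nat_numeral)
      moreover have "real s * (\<delta> * \<sigma> / 2) \<le> (160 * real (p * p)) * real m"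
        using sp m_half \<delta>\<sigma> by (intro mult_mono) auto
      ultimately have "real s * (\<delta> * \<sigma> / 2) \<le> 160 * (2 * real (dag_size t))" by linarith
      then show ?thesis by (simp add: mult_ac)
    qed
    moreover have "set S \<subseteq> {0..<\<sigma>}" using S(1) letters by fastforce
    ultimately show ?thesis using S(2) by (intro exI[of _ S]) simp
  qed
  show ?thesis
    by (rule exI[of _ "\<delta> / 640"], rule conjI, use \<delta>(1) in simp, rule exI[of _ \<sigma>\<^sub>0])
      (use main in blast)
qed

end
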